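(* Let $k=\mathbb{C}$, let $\Sigma_g$ be a closed orientable surface of genus $g\geq 0$, and let $N_{r}$ denote the connected sum of $r$ projective planes. Then the virtual class in $\mathrm{K}_0^{\mathbb{P}^1}(\mathrm{Var}_k)$ of the $\mathrm{SL}_2$-representation variety of $\Sigma_g$ equals $$[R_{\mathrm{SL}_2}(\Sigma_g)] = [R_{\mathrm{SL}_2}(N_{2g})].$$
   Context: The Grothendieck ring of varieties $\mathrm{K}_0(\mathrm{Var}_k)$ is the quotient of the free abelian group on isomorphism classes of varieties over $k$ by the relations $[X]=[Z]+[X\setminus Z]$ for every closed subvariety $Z\subset X$, with multiplication $[X]\cdot[Y]=[X\times_k Y]$. The ring $\mathrm{K}_0^{\mathbb{P}^1}(\mathrm{Var}_k)$ is the quotient of $\mathrm{K}_0(\mathrm{Var}_k)$ by all relations $[P]=[\mathbb{P}^1_k][X]$ for $\mathbb{P}^1$-fibrations $P\to X$ over $k$. The virtual class of a variety is its image in the relevant ring. For an algebraic group $G$ over $k$, the $G$-representation varieties are $$R_G(\Sigma_g)=\Big\{(A_1,B_1,\dots,A_g,B_g)\in G^{2g} : \prod_{i=1}^g [A_i,B_i]=1\Big\},\qquad R_G(N_r)=\{(A_1,\dots,A_r)\in G^r : A_1^2\cdots A_r^2=1\},$$ closed subvarieties of $G^{2g}$ and $G^r$, where $[A,B]=ABA^{-1}B^{-1}$; for $g=0$, respectively $r=0$, these are a point. *)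

theory Defs
  imports "HOL-Analysis.Analysis" "HOL-Algebra.Free_Abelian_Groups" "HOL-Algebra.QuotRing"
begin

section \<open>Varieties over the complex numbers\<close>

text \<open>
  A variety over the algebraically closed field of complex numbers (reduced, separated, of finite
  type, not necessarily irreducible) is presented in the style of Serre: by its set of closed points
  with the Zariski topology and the sheaf of complex-valued regular functions.

  \<open>funs X U\<close> is only meaningful for open \<open>U\<close>, and membership of \<open>f\<close> in it only depends on the values
  of \<open>f\<close> on \<open>U\<close> (see \<open>sheaf_of_functions\<close>).
\<close>

record 'a fspace =
  topo :: "'a topology"
  funs :: "'a set \<Rightarrow> ('a \<Rightarrow> complex) set"

abbreviation points :: "'a fspace \<Rightarrow> 'a set" where
  "points X \<equiv> topspace (topo X)"

definition morphism :: "'a fspace \<Rightarrow> 'b fspace \<Rightarrow> ('a \<Rightarrow> 'b) \<Rightarrow> bool" where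
  "morphism X Y \<phi> \<longleftrightarrow> continuous_map (topo X) (topo Y) \<phi> \<and>
     (\<forall>V f. openin (topo Y) V \<and> f \<in> funs Y V \<longrightarrow> f \<circ> \<phi> \<in> funs X {x \<in> points X. \<phi> x \<in> V})"

definition isomorphism :: "'a fspace \<Rightarrow> 'b fspace \<Rightarrow> ('a \<Rightarrow> 'b) \<Rightarrow> bool" where
  "isomorphism X Y \<phi> \<longleftrightarrow> morphism X Y \<phi> \<and>
     (\<exists>\<psi>. morphism Y X \<psi> \<and> (\<forall>x\<in>points X. \<psi> (\<phi> x) = x) \<and> (\<forall>y\<in>points Y. \<phi> (\<psi> y) = y))"

definition isomorphic :: "'a fspace \<Rightarrow> 'b fspace \<Rightarrow> bool" (infix \<open>\<simeq>\<^sub>v\<close> 50) where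
  "X \<simeq>\<^sub>v Y \<longleftrightarrow> (\<exists>\<phi>. isomorphism X Y \<phi>)"

definition sheaf_of_functions :: "'a fspace \<Rightarrow> bool" where
  "sheaf_of_functions X \<longleftrightarrow>
     (\<forall>U V f. openin (topo X) U \<and> openin (topo X) V \<and> U \<subseteq> V \<and> f \<in> funs X V \<longrightarrow> f \<in> funs X U) \<and>
     (\<forall>U f. openin (topo X) U \<and>
        (\<forall>x\<in>U. \<exists>V g. openin (topo X) V \<and> x \<in> V \<and> V \<subseteq> U \<and> g \<in> funs X V \<and> (\<forall>y\<in>V. f y = g y))
        \<longrightarrow> f \<in> funs X U)"

text \<open>
  The (reduced) structure induced on a subset, used for open and for closed subvarieties:
  a function is regular if it locally extends to a regular function on an open set of \<open>X\<close>.
\<close>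

definition induced :: "'a fspace \<Rightarrow> 'a set \<Rightarrow> 'a fspace" where
  "induced X S = \<lparr>topo = subtopology (topo X) S,
     funs = (\<lambda>V. {f. \<forall>x\<in>V. \<exists>U g. openin (topo X) U \<and> x \<in> U \<and> g \<in> funs X U \<and>
                                  (\<forall>y\<in>U \<inter> V. f y = g y)})\<rparr>"

text \<open>
  Polynomial functions in a given set \<open>C\<close> of coordinate functions. Since the field is infinite,
  these are the same as polynomials when \<open>C\<close> consists of the coordinates of an affine space.
\<close>

inductive_set polys :: "('a \<Rightarrow> complex) set \<Rightarrow> ('a \<Rightarrow> complex) set"
  for C :: "('a \<Rightarrow> complex) set" where
  polys_const: "(\<lambda>_. c) \<in> polys C"
| polys_coord: "x \<in> C \<Longrightarrow> x \<in> polys C"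
| polys_add: "p \<in> polys C \<Longrightarrow> q \<in> polys C \<Longrightarrow> (\<lambda>v. p v + q v) \<in> polys C"
| polys_mult: "p \<in> polys C \<Longrightarrow> q \<in> polys C \<Longrightarrow> (\<lambda>v. p v * q v) \<in> polys C"

text \<open>
  The set \<open>V\<close> with the Zariski topology (generated by the principal open sets) and the sheaf of
  functions that are locally quotients of polynomials in the coordinates \<open>C\<close>.
\<close>

definition zariski :: "'a set \<Rightarrow> ('a \<Rightarrow> complex) set \<Rightarrow> 'a fspace" where
  "zariski V C = \<lparr>topo = topology_generated_by {{v \<in> V. p v \<noteq> 0} | p. p \<in> polys C},
     funs = (\<lambda>U. {f. \<forall>v\<in>U. \<exists>W p q.
        openin (topology_generated_by {{v \<in> V. p v \<noteq> 0} | p. p \<in> polys C}) W \<and> v \<in> W \<and> W \<subseteq> U \<and>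
        p \<in> polys C \<and> q \<in> polys C \<and> (\<forall>w\<in>W. q w \<noteq> 0 \<and> f w = p w / q w)})\<rparr>"

text \<open>Points of affine \<open>n\<close>-space are the lists of length \<open>n\<close>.\<close>

definition coords :: "nat \<Rightarrow> (complex list \<Rightarrow> complex) set" where
  "coords n = {\<lambda>v. v ! i | i. i < n}"

definition algebraic_set :: "nat \<Rightarrow> complex list set \<Rightarrow> bool" where
  "algebraic_set n V \<longleftrightarrow> (\<exists>S \<subseteq> polys (coords n). V = {v. length v = n \<and> (\<forall>p\<in>S. p v = 0)})"

definition affine_variety :: "'a fspace \<Rightarrow> bool" where
  "affine_variety X \<longleftrightarrow> (\<exists>n V. algebraic_set n V \<and> X \<simeq>\<^sub>v zariski V (coords n))"

text \<open>
  The product of varieties: \<open>tensors X Y U V\<close> consists of the functions \<open>\<Sum>\<^sub>i f\<^sub>i(x) g\<^sub>i(y)\<close> with \<open>f\<^sub>i\<close>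
  regular on \<open>U\<close> and \<open>g\<^sub>i\<close> regular on \<open>V\<close>. The topology is generated by their non-vanishing loci
  (so it is finer than the product topology), and regular functions are locally quotients of them.
\<close>

inductive_set tensors :: "'a fspace \<Rightarrow> 'b fspace \<Rightarrow> 'a set \<Rightarrow> 'b set \<Rightarrow> ('a \<times> 'b \<Rightarrow> complex) set"
  for X :: "'a fspace" and Y :: "'b fspace" and U :: "'a set" and V :: "'b set" where
  tensors_pure: "f \<in> funs X U \<Longrightarrow> g \<in> funs Y V \<Longrightarrow> (\<lambda>z. f (fst z) * g (snd z)) \<in> tensors X Y U V"
| tensors_add: "h \<in> tensors X Y U V \<Longrightarrow> k \<in> tensors X Y U V \<Longrightarrow> (\<lambda>z. h z + k z) \<in> tensors X Y U V"

definition prod_topo :: "'a fspace \<Rightarrow> 'b fspace \<Rightarrow> ('a \<times> 'b) topology" where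
  "prod_topo X Y = topology_generated_by
     {{z \<in> U \<times> V. h z \<noteq> 0} | U V h. openin (topo X) U \<and> openin (topo Y) V \<and> h \<in> tensors X Y U V}"

definition vprod :: "'a fspace \<Rightarrow> 'b fspace \<Rightarrow> ('a \<times> 'b) fspace" (infixr \<open>\<times>\<^sub>v\<close> 70) where
  "X \<times>\<^sub>v Y = \<lparr>topo = prod_topo X Y,
     funs = (\<lambda>N. {f. \<forall>z\<in>N. \<exists>W U V h k. openin (prod_topo X Y) W \<and> z \<in> W \<and> W \<subseteq> N \<and>
        openin (topo X) U \<and> openin (topo Y) V \<and> W \<subseteq> U \<times> V \<and>
        h \<in> tensors X Y U V \<and> k \<in> tensors X Y U V \<and> (\<forall>w\<in>W. k w \<noteq> 0 \<and> f w = h w / k w)})\<rparr>"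

definition separated :: "'a fspace \<Rightarrow> bool" where
  "separated X \<longleftrightarrow> closedin (topo (X \<times>\<^sub>v X)) {(x, x) | x. x \<in> points X}"

definition variety :: "'a fspace \<Rightarrow> bool" where
  "variety X \<longleftrightarrow> sheaf_of_functions X \<and> separated X \<and>
     (\<exists>\<U>. finite \<U> \<and> \<Union>\<U> = points X \<and> (\<forall>U\<in>\<U>. openin (topo X) U \<and> affine_variety (induced X U)))"


subsection \<open>Projective space\<close>

definition line_through :: "complex list \<Rightarrow> complex list set" where
  "line_through v = {map ((*) c) v | c. c \<noteq> 0}"

definition nonzero_vectors :: "nat \<Rightarrow> complex list set" where
  "nonzero_vectors m = {v. length v = m \<and> (\<exists>i<m. v ! i \<noteq> 0)}"

definition homogeneous :: "nat \<Rightarrow> nat \<Rightarrow> (complex list \<Rightarrow> complex) set" where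
  "homogeneous m d = {F \<in> polys (coords m). \<forall>c v. length v = m \<longrightarrow> F (map ((*) c) v) = c ^ d * F v}"

definition proj_topo :: "nat \<Rightarrow> complex list set topology" where
  "proj_topo n = topology_generated_by
     {line_through ` {v \<in> nonzero_vectors (Suc n). F v \<noteq> 0} | F d. F \<in> homogeneous (Suc n) d}"

definition proj_space :: "nat \<Rightarrow> complex list set fspace" (\<open>\<P>\<close>) where
  "\<P> n = \<lparr>topo = proj_topo n,
     funs = (\<lambda>U. {f. \<forall>l\<in>U. \<exists>W d F G. openin (proj_topo n) W \<and> l \<in> W \<and> W \<subseteq> U \<and>
        F \<in> homogeneous (Suc n) d \<and> G \<in> homogeneous (Suc n) d \<and>
        (\<forall>v\<in>nonzero_vectors (Suc n). line_through v \<in> W \<longrightarrow>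
           G v \<noteq> 0 \<and> f (line_through v) = F v / G v)})\<rparr>"


subsection \<open>Etale morphisms and fibrations with fibre the projective line\<close>

text \<open>
  \<open>max_power X x U n\<close> is the \<open>n\<close>-th power of the ideal of functions in \<open>funs X U\<close> vanishing at \<open>x\<close>;
  \<open>germ_in_max_power X x n f\<close> says that the germ of \<open>f\<close> at \<open>x\<close> lies in the \<open>n\<close>-th power of the
  maximal ideal of the local ring at \<open>x\<close>.
\<close>

inductive max_power :: "'a fspace \<Rightarrow> 'a \<Rightarrow> 'a set \<Rightarrow> nat \<Rightarrow> ('a \<Rightarrow> complex) \<Rightarrow> bool"
  for X :: "'a fspace" and x :: 'a and U :: "'a set" where
  "f \<in> funs X U \<Longrightarrow> max_power X x U 0 f"
| "f \<in> funs X U \<Longrightarrow> f x = 0 \<Longrightarrow> max_power X x U n g \<Longrightarrow> max_power X x U (Suc n) (\<lambda>y. f y * g y)"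
| "max_power X x U n f \<Longrightarrow> max_power X x U n g \<Longrightarrow> max_power X x U n (\<lambda>y. f y + g y)"

definition germ_in_max_power :: "'a fspace \<Rightarrow> 'a \<Rightarrow> nat \<Rightarrow> ('a \<Rightarrow> complex) \<Rightarrow> bool" where
  "germ_in_max_power X x n f \<longleftrightarrow>
     (\<exists>U g. openin (topo X) U \<and> x \<in> U \<and> max_power X x U n g \<and> (\<forall>y\<in>U. f y = g y))"

text \<open>
  Over an algebraically closed field, a morphism of varieties is etale iff it induces an isomorphism
  of completed local rings at every closed point, i.e. iff the induced maps of the quotients of the
  local rings by the \<open>n\<close>-th powers of the maximal ideals are injective and surjective for all \<open>n\<close>.
\<close>

definition etale :: "'a fspace \<Rightarrow> 'b fspace \<Rightarrow> ('a \<Rightarrow> 'b) \<Rightarrow> bool" where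
  "etale Y X \<phi> \<longleftrightarrow> morphism Y X \<phi> \<and> (\<forall>y\<in>points Y. \<forall>n.
     (\<forall>U f. openin (topo X) U \<and> \<phi> y \<in> U \<and> f \<in> funs X U \<and> germ_in_max_power Y y n (f \<circ> \<phi>)
        \<longrightarrow> germ_in_max_power X (\<phi> y) n f) \<and>
     (\<forall>V g. openin (topo Y) V \<and> y \<in> V \<and> g \<in> funs Y V \<longrightarrow>
        (\<exists>U f. openin (topo X) U \<and> \<phi> y \<in> U \<and> f \<in> funs X U \<and>
               germ_in_max_power Y y n (\<lambda>z. g z - f (\<phi> z)))))"

text \<open>
  The reduced fibre product. When one of the two morphisms is etale (the only case used), the fibre
  product of varieties is reduced, so that this is the scheme-theoretic one.
\<close>

definition fibre_product ::
  "'a fspace \<Rightarrow> ('a \<Rightarrow> 'c) \<Rightarrow> 'b fspace \<Rightarrow> ('b \<Rightarrow> 'c) \<Rightarrow> ('a \<times> 'b) fspace" where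
  "fibre_product X \<phi> Y \<psi> = induced (X \<times>\<^sub>v Y) {(x, y). x \<in> points X \<and> y \<in> points Y \<and> \<phi> x = \<psi> y}"

text \<open>
  The type of points used for representatives of isomorphism classes. As a complex variety has at
  most continuum many points, every variety (on any type) is isomorphic to one on this type.
\<close>

type_synonym pt = "complex list"

text \<open>
  Fibrations with fibre \<open>\<P> 1\<close> are locally trivial in the etale topology. A finite etale covering
  family can be replaced by its disjoint union, hence by a single covering.
\<close>

definition P1_fibration :: "'a fspace \<Rightarrow> 'b fspace \<Rightarrow> ('a \<Rightarrow> 'b) \<Rightarrow> bool" where
  "P1_fibration P X \<pi> \<longleftrightarrow> variety P \<and> variety X \<and> morphism P X \<pi> \<and>
     (\<exists>(U :: pt fspace) e \<Phi>. variety U \<and> etale U X e \<and> e ` points U = points X \<and>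
        isomorphism (fibre_product U e P \<pi>) (U \<times>\<^sub>v \<P> 1) \<Phi> \<and>
        (\<forall>z\<in>points (fibre_product U e P \<pi>). fst (\<Phi> z) = fst z))"


section \<open>The Grothendieck ring of varieties\<close>

type_synonym iso_class = "pt fspace set"

definition iso_class :: "'a fspace \<Rightarrow> iso_class" where
  "iso_class X = {Y. variety Y \<and> X \<simeq>\<^sub>v Y}"

definition iso_classes :: "iso_class set" where
  "iso_classes = {iso_class X | X :: pt fspace. variety X}"

definition class_prod :: "iso_class \<Rightarrow> iso_class \<Rightarrow> iso_class" where
  "class_prod a b = {Z. variety Z \<and> (\<exists>X\<in>a. \<exists>Y\<in>b. X \<times>\<^sub>v Y \<simeq>\<^sub>v Z)}"

text \<open>
  The free abelian group on isomorphism classes, with the biadditive extension of the product;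
  the unit is the class of the point, i.e. of affine \<open>0\<close>-space.
\<close>

definition free_var_ring :: "(iso_class \<Rightarrow>\<^sub>0 int) ring" where
  "free_var_ring =
     \<lparr>carrier = carrier (free_Abelian_group iso_classes),
      mult = (\<lambda>a b. frag_extend (\<lambda>s. frag_extend (\<lambda>t. frag_of (class_prod s t)) b) a),
      one = frag_of (iso_class (zariski {[]} (coords 0))),
      zero = 0,
      add = (+)\<rparr>"

text \<open>
  The additive subgroup generated by the scissor relations. It is an ideal, because products with a
  fixed variety preserve closed and open subvarieties.
\<close>

definition scissor_relations :: "(iso_class \<Rightarrow>\<^sub>0 int) set" where
  "scissor_relations = generate (add_monoid free_var_ring)
     {frag_of (iso_class X) - (frag_of (iso_class (induced X Z))
                               + frag_of (iso_class (induced X (points X - Z)))) |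
      (X :: pt fspace) Z. variety X \<and> closedin (topo X) Z}"

definition K0_Var :: "(iso_class \<Rightarrow>\<^sub>0 int) set ring" where
  "K0_Var = free_var_ring Quot scissor_relations"

definition K0_class :: "'a fspace \<Rightarrow> (iso_class \<Rightarrow>\<^sub>0 int) set" where
  "K0_class X = scissor_relations +>\<^bsub>free_var_ring\<^esub> frag_of (iso_class X)"

text \<open>
  The ideal generated by the relations for fibrations with fibre \<open>\<P> 1\<close>: as \<open>K0_Var\<close> is commutative
  with unit, it is the additive subgroup generated by all multiples of the relations. (This is written
  out because \<open>genideal\<close> would silently become the whole type if \<open>K0_Var\<close> failed to be a ring.)
\<close>

definition P1_relations :: "(iso_class \<Rightarrow>\<^sub>0 int) set set" where
  "P1_relations = generate (add_monoid K0_Var)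
     {r \<otimes>\<^bsub>K0_Var\<^esub> (K0_class P \<ominus>\<^bsub>K0_Var\<^esub> K0_class (\<P> 1) \<otimes>\<^bsub>K0_Var\<^esub> K0_class X) |
      r (P :: pt fspace) (X :: pt fspace). r \<in> carrier K0_Var \<and> (\<exists>\<pi>. P1_fibration P X \<pi>)}"

definition K0_P1_Var :: "(iso_class \<Rightarrow>\<^sub>0 int) set set ring" where
  "K0_P1_Var = K0_Var Quot P1_relations"

definition virtual_class :: "'a fspace \<Rightarrow> (iso_class \<Rightarrow>\<^sub>0 int) set set" where
  "virtual_class X = P1_relations +>\<^bsub>K0_Var\<^esub> K0_class X"


section \<open>Representation varieties\<close>

definition commutator :: "('a, 'b) monoid_scheme \<Rightarrow> 'a \<Rightarrow> 'a \<Rightarrow> 'a" where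
  "commutator G a b = a \<otimes>\<^bsub>G\<^esub> b \<otimes>\<^bsub>G\<^esub> inv\<^bsub>G\<^esub> a \<otimes>\<^bsub>G\<^esub> inv\<^bsub>G\<^esub> b"

definition list_prod :: "('a, 'b) monoid_scheme \<Rightarrow> 'a list \<Rightarrow> 'a" where
  "list_prod G xs = foldr (\<lambda>x y. x \<otimes>\<^bsub>G\<^esub> y) xs \<one>\<^bsub>G\<^esub>"

text \<open>
  A representation \<open>(A\<^sub>1, B\<^sub>1, \<dots>, A\<^sub>g, B\<^sub>g)\<close> of the fundamental group of the closed orientable surface
  of genus \<open>g\<close> is a list of length \<open>2g\<close>, with \<open>A\<close>'s in the even and \<open>B\<close>'s in the odd positions
  (counting from \<open>0\<close>).
\<close>

definition reps_orientable :: "('a, 'b) monoid_scheme \<Rightarrow> nat \<Rightarrow> 'a list set" where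
  "reps_orientable G g = {x. length x = 2 * g \<and> set x \<subseteq> carrier G \<and>
     list_prod G (map (\<lambda>i. commutator G (x ! (2 * i)) (x ! (2 * i + 1))) [0..<g]) = \<one>\<^bsub>G\<^esub>}"

definition reps_nonorientable :: "('a, 'b) monoid_scheme \<Rightarrow> nat \<Rightarrow> 'a list set" where
  "reps_nonorientable G r = {x. length x = r \<and> set x \<subseteq> carrier G \<and>
     list_prod G (map (\<lambda>a. a \<otimes>\<^bsub>G\<^esub> a) x) = \<one>\<^bsub>G\<^esub>}"

definition SL2 :: "(complex ^ 2 ^ 2) monoid" where
  "SL2 = \<lparr>carrier = {A. det A = 1}, monoid.mult = (**), one = mat 1\<rparr>"

text \<open>
  The representation varieties carry the structure of closed subvarieties of the affine space of
  tuples of matrices, given by the matrix entries.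
\<close>

definition matrix_coords :: "nat \<Rightarrow> ((complex ^ 2 ^ 2) list \<Rightarrow> complex) set" where
  "matrix_coords m = {\<lambda>x. x ! k $ i $ j | k i j. k < m}"

definition R_SL2_orientable :: "nat \<Rightarrow> (complex ^ 2 ^ 2) list fspace" where
  "R_SL2_orientable g = zariski (reps_orientable SL2 g) (matrix_coords (2 * g))"

definition R_SL2_nonorientable :: "nat \<Rightarrow> (complex ^ 2 ^ 2) list fspace" where
  "R_SL2_nonorientable r = zariski (reps_nonorientable SL2 r) (matrix_coords r)"

end

(*
  If h c h^-1 = c^-1 in a group, then [a, c] = a'^2 b'^2 for a' = a h and b' = (a h)^-1 c^-1, and
  c = (a' b')^-1 and a = a' h^-1 can be recovered from (a', b'). Over the complex numbers every c in
  SL2 is conjugate to its inverse, and the conjugating h can be chosen to be a regular function of c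
  on each of the strata c12 <> 0, c12 = 0 <> c21, and c12 = c21 = 0. Replacing the commutators by
  products of two squares one at a time, one gets a chain of varieties from the orientable to the
  nonorientable representation variety; neighbours decompose into three isomorphic locally closed
  pieces, so their classes agree, even before dividing by the relations for fibrations.
*)
theory Submission
  imports Defs
begin

text \<open>The formulas for h solve a small linear problem. By Cayley-Hamilton the inverse of c is
  tr(c) - c, so h c = c^-1 h says that h anticommutes with the traceless part of c. For traceless h
  with rows (x, y) and (z, -x) this is the single equation (c11 - c22) x + c21 y + c12 z = 0, and
  det h = 1 reads -x^2 - y z = 1. Putting y = 0 or z = 0 forces x to be a square root of -1 and
  leaves a denominator c12 or c21; this is where the three strata come from. Over the reals there is
  no h of determinant 1 when c is a rotation other than 1 and -1.

  The scissor relations are available for varieties only, so each piece that is cut further must be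
  shown to be one. Hence the strata are cut out by one function at a time: both halves of such a cut
  are again principal open subsets of closed sets, and therefore affine, whereas the complement of a
  general closed subset need not be affine.\<close>

section \<open>Morphisms and isomorphisms\<close>

lemma morphism_compose:
  assumes "morphism X Y f" "morphism Y Z g"
  shows "morphism X Z (g \<circ> f)"
  unfolding morphism_def
proof (intro conjI allI impI)
  show "continuous_map (topo X) (topo Z) (g \<circ> f)"
    using assms unfolding morphism_def by (auto intro: continuous_map_compose)
  fix V u assume *: "openin (topo Z) V \<and> u \<in> funs Z V"
  let ?V = "{y \<in> points Y. g y \<in> V}"
  have "openin (topo Y) ?V" "u \<circ> g \<in> funs Y ?V"
    using * assms(2) openin_continuous_map_preimage unfolding morphism_def by blast+
  then have "(u \<circ> g) \<circ> f \<in> funs X {x \<in> points X. f x \<in> ?V}"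
    using assms(1) unfolding morphism_def by blast
  moreover have "{x \<in> points X. f x \<in> ?V} = {x \<in> points X. (g \<circ> f) x \<in> V}"
    using assms(1) continuous_map_funspace unfolding morphism_def by fastforce
  ultimately show "u \<circ> (g \<circ> f) \<in> funs X {x \<in> points X. (g \<circ> f) x \<in> V}"
    by (simp add: comp_assoc)
qed

lemma morphism_points: "morphism X Y f \<Longrightarrow> x \<in> points X \<Longrightarrow> f x \<in> points Y"
  using continuous_map_funspace unfolding morphism_def by fastforce

lemma isomorphicI:
  assumes "morphism X Y f" "morphism Y X g"
    "\<And>x. x \<in> points X \<Longrightarrow> g (f x) = x" "\<And>y. y \<in> points Y \<Longrightarrow> f (g y) = y"
  shows "X \<simeq>\<^sub>v Y"
  using assms unfolding isomorphic_def isomorphism_def by blast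

lemma isomorphicE:
  assumes "X \<simeq>\<^sub>v Y"
  obtains f g where "morphism X Y f" "morphism Y X g"
    "\<And>x. x \<in> points X \<Longrightarrow> g (f x) = x" "\<And>y. y \<in> points Y \<Longrightarrow> f (g y) = y"
  using assms unfolding isomorphic_def isomorphism_def by blast

lemma isomorphic_sym: "X \<simeq>\<^sub>v Y \<Longrightarrow> Y \<simeq>\<^sub>v X"
  by (metis isomorphicE isomorphicI)

lemma isomorphic_trans:
  assumes "X \<simeq>\<^sub>v Y" "Y \<simeq>\<^sub>v Z"
  shows "X \<simeq>\<^sub>v Z"
proof -
  obtain f g where fg: "morphism X Y f" "morphism Y X g"
    "\<And>x. x \<in> points X \<Longrightarrow> g (f x) = x" "\<And>y. y \<in> points Y \<Longrightarrow> f (g y) = y"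
    using isomorphicE[OF assms(1)] by blast
  obtain f' g' where fg': "morphism Y Z f'" "morphism Z Y g'"
    "\<And>x. x \<in> points Y \<Longrightarrow> g' (f' x) = x" "\<And>y. y \<in> points Z \<Longrightarrow> f' (g' y) = y"
    using isomorphicE[OF assms(2)] by blast
  show ?thesis
  proof (rule isomorphicI)
    show "morphism X Z (f' \<circ> f)" "morphism Z X (g \<circ> g')"
      using fg fg' morphism_compose by blast+
  qed (use fg fg' morphism_points[OF fg(1)] morphism_points[OF fg'(2)] in auto)
qed

text \<open>The members of \<open>iso_class X\<close> live on the type \<open>pt\<close>, whatever
  the point types of \<open>X\<close> and \<open>Y\<close> are. This is how a variety of matrix
  tuples and its version in coordinate lists come to have the very same class.\<close>

lemma iso_class_cong: "X \<simeq>\<^sub>v Y \<Longrightarrow> iso_class X = iso_class Y"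
  unfolding iso_class_def by (auto intro: isomorphic_trans isomorphic_trans[OF isomorphic_sym])


section \<open>Zariski spaces\<close>

text \<open>A common interface for \<open>polys C\<close> and \<open>rational_on C V\<close>: the
  closure properties of matrix-valued functions are proved once and then serve both the equations of
  the varieties and the maps between them.\<close>

definition function_algebra :: "('a \<Rightarrow> complex) set \<Rightarrow> bool" where
  "function_algebra R \<longleftrightarrow> (\<forall>c. (\<lambda>_. c) \<in> R) \<and>
     (\<forall>f\<in>R. \<forall>g\<in>R. (\<lambda>x. f x + g x) \<in> R \<and> (\<lambda>x. f x * g x) \<in> R)"

text \<open>A single quotient has to work on all of \<open>V\<close>, which is stronger than the
  local condition in \<open>zariski\<close>. The maps between strata satisfy it, so no patching of
  local expressions arises.\<close>

definition rational_on :: "('a \<Rightarrow> complex) set \<Rightarrow> 'a set \<Rightarrow> ('a \<Rightarrow> complex) set" where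
  "rational_on C V =
     {f. \<exists>p\<in>polys C. \<exists>q\<in>polys C. \<forall>v\<in>V. q v \<noteq> 0 \<and> f v = p v / q v}"

lemma function_algebra_const: "function_algebra R \<Longrightarrow> (\<lambda>_. c) \<in> R"
  and function_algebra_add: "function_algebra R \<Longrightarrow> f \<in> R \<Longrightarrow> g \<in> R \<Longrightarrow> (\<lambda>x. f x + g x) \<in> R"
  and function_algebra_mult: "function_algebra R \<Longrightarrow> f \<in> R \<Longrightarrow> g \<in> R \<Longrightarrow> (\<lambda>x. f x * g x) \<in> R"
  unfolding function_algebra_def by blast+

lemma function_algebra_uminus: "function_algebra R \<Longrightarrow> f \<in> R \<Longrightarrow> (\<lambda>x. - f x) \<in> R"
  using function_algebra_mult[OF _ function_algebra_const[of R "-1"], of f] by simp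

lemma function_algebra_diff:
  "function_algebra R \<Longrightarrow> f \<in> R \<Longrightarrow> g \<in> R \<Longrightarrow> (\<lambda>x. f x - g x) \<in> R"
  using function_algebra_add[OF _ _ function_algebra_uminus, of R f g] by simp

lemmas function_algebra_intros = function_algebra_const function_algebra_add
  function_algebra_mult function_algebra_uminus function_algebra_diff

lemma function_algebra_polys: "function_algebra (polys C)"
  unfolding function_algebra_def by (auto intro: polys.intros)

lemma rational_onI:
  assumes "p \<in> polys C" "q \<in> polys C" "\<And>v. v \<in> V \<Longrightarrow> q v \<noteq> 0 \<and> f v = p v / q v"
  shows "f \<in> rational_on C V"
  using assms unfolding rational_on_def by blast

lemma polys_subset_rational_on: "polys C \<subseteq> rational_on C V"
  by (auto intro: rational_onI[where q = "\<lambda>_. 1"] polys_const)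

lemma function_algebra_rational_on: "function_algebra (rational_on C V)"
  unfolding function_algebra_def
proof (intro conjI allI ballI)
  show "(\<lambda>_. c) \<in> rational_on C V" for c
    using polys_subset_rational_on polys_const by blast
  fix f g assume "f \<in> rational_on C V" "g \<in> rational_on C V"
  then obtain p q r s where *: "p \<in> polys C" "q \<in> polys C" "r \<in> polys C" "s \<in> polys C"
    "\<forall>v\<in>V. q v \<noteq> 0 \<and> f v = p v / q v" "\<forall>v\<in>V. s v \<noteq> 0 \<and> g v = r v / s v"
    unfolding rational_on_def by blast
  have "(\<lambda>v. p v * s v + r v * q v) \<in> polys C" "(\<lambda>v. p v * r v) \<in> polys C"
    "(\<lambda>v. q v * s v) \<in> polys C"
    using * by (auto intro: polys.intros)
  then show "(\<lambda>x. f x + g x) \<in> rational_on C V" "(\<lambda>x. f x * g x) \<in> rational_on C V"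
    using *(5,6)
    by (auto intro: rational_onI[where q = "\<lambda>v. q v * s v" and p = "\<lambda>v. p v * s v + r v * q v"]
        rational_onI[where q = "\<lambda>v. q v * s v" and p = "\<lambda>v. p v * r v"] simp: add_frac_eq)
qed

lemma rational_on_divide:
  assumes "f \<in> rational_on C V" "g \<in> rational_on C V" "\<And>v. v \<in> V \<Longrightarrow> g v \<noteq> 0"
  shows "(\<lambda>x. f x / g x) \<in> rational_on C V"
proof -
  obtain r s where *: "r \<in> polys C" "s \<in> polys C" "\<forall>v\<in>V. s v \<noteq> 0 \<and> g v = r v / s v"
    using assms(2) unfolding rational_on_def by blast
  have "(\<lambda>x. 1 / g x) \<in> rational_on C V"
    by (rule rational_onI[OF *(2,1)]) (use * assms(3) in force)
  from function_algebra_mult[OF function_algebra_rational_on assms(1) this] show ?thesis by simp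
qed

lemma rational_on_cong:
  assumes "f \<in> rational_on C V" "\<And>v. v \<in> V \<Longrightarrow> g v = f v"
  shows "g \<in> rational_on C V"
  using assms unfolding rational_on_def by auto

section \<open>Zariski topology, and morphisms given by quotients of polynomials\<close>

lemma topo_zariski: "topo (zariski V C) = topology_generated_by {{v \<in> V. p v \<noteq> 0} | p. p \<in> polys C}"
  unfolding zariski_def by simp

lemma points_zariski [simp]: "points (zariski V C) = V"
proof -
  have "V = {v \<in> V. (\<lambda>_. 1::complex) v \<noteq> 0}" by simp
  then have "V \<in> {{v \<in> V. p v \<noteq> 0} | p. p \<in> polys C}"
    using polys_const[of 1 C] by (auto intro!: exI[of _ "\<lambda>_. 1"])
  then show ?thesis unfolding topo_zariski topology_generated_by_topspace by blast
qed

lemma openin_zariski_basic: "p \<in> polys C \<Longrightarrow> openin (topo (zariski V C)) {v \<in> V. p v \<noteq> 0}"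
  unfolding topo_zariski by (rule topology_generated_by_Basis) blast

lemma closedin_zariski_basic: "p \<in> polys C \<Longrightarrow> closedin (topo (zariski V C)) {v \<in> V. p v = 0}"
proof -
  assume "p \<in> polys C"
  moreover have "V - {v \<in> V. p v = 0} = {v \<in> V. p v \<noteq> 0}" by blast
  ultimately show ?thesis unfolding closedin_def using openin_zariski_basic[of p C V] by auto
qed

lemma funs_zariski:
  "funs (zariski V C) U = {f. \<forall>v\<in>U. \<exists>W p q. openin (topo (zariski V C)) W \<and> v \<in> W \<and> W \<subseteq> U \<and>
        p \<in> polys C \<and> q \<in> polys C \<and> (\<forall>w\<in>W. q w \<noteq> 0 \<and> f w = p w / q w)}"
  unfolding topo_zariski unfolding zariski_def by simp

lemma rational_on_pullback:
  assumes "\<And>d. d \<in> D \<Longrightarrow> d \<circ> \<phi> \<in> rational_on C V" "p \<in> polys D"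
  shows "p \<circ> \<phi> \<in> rational_on C V"
  using assms(2)
  by induction (auto simp: comp_def assms(1)[unfolded comp_def]
      intro: function_algebra_intros[OF function_algebra_rational_on])

text \<open>It is enough to look at coordinates. A polynomial pulls back to a quotient r / s with s
  nowhere zero on \<open>V\<close>, so its non-vanishing locus pulls back to that of r, and a local
  quotient of polynomials pulls back to a quotient of two such quotients.\<close>

lemma morphism_zariski:
  assumes "\<And>v. v \<in> V \<Longrightarrow> \<phi> v \<in> W" "\<And>d. d \<in> D \<Longrightarrow> d \<circ> \<phi> \<in> rational_on C V"
  shows "morphism (zariski V C) (zariski W D) \<phi>"
proof -
  have basic: "openin (topo (zariski V C)) (\<phi> -` {w \<in> W. p w \<noteq> 0} \<inter> V)" if p: "p \<in> polys D" for p
  proof -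
    obtain r s where rs: "r \<in> polys C" "s \<in> polys C" "\<forall>v\<in>V. s v \<noteq> 0 \<and> (p \<circ> \<phi>) v = r v / s v"
      using rational_on_pullback[OF assms(2) p] unfolding rational_on_def by auto
    then have "\<phi> -` {w \<in> W. p w \<noteq> 0} \<inter> V = {v \<in> V. r v \<noteq> 0}"
      using assms(1) by auto
    then show ?thesis using openin_zariski_basic rs(1) by metis
  qed
  have cont: "continuous_map (topo (zariski V C)) (topo (zariski W D)) \<phi>"
    unfolding topo_zariski[of W D] continuous_on_generated_topo_iff
  proof (intro conjI allI impI)
    show "\<phi> ` points (zariski V C) \<subseteq> \<Union>{{v \<in> W. p v \<noteq> 0} |p. p \<in> polys D}"
      using assms(1) points_zariski[of W D]
      unfolding topo_zariski[of W D] topology_generated_by_topspace by auto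
  qed (use basic in auto)
  show ?thesis unfolding morphism_def
  proof (intro conjI cont allI impI)
    fix U f assume *: "openin (topo (zariski W D)) U \<and> f \<in> funs (zariski W D) U"
    let ?U = "{x \<in> points (zariski V C). \<phi> x \<in> U}"
    show "f \<circ> \<phi> \<in> funs (zariski V C) ?U"
      unfolding funs_zariski
    proof (intro CollectI ballI)
      fix v assume v: "v \<in> ?U"
      then obtain N p q where N: "openin (topo (zariski W D)) N" "\<phi> v \<in> N" "N \<subseteq> U"
        "p \<in> polys D" "q \<in> polys D" "\<forall>w\<in>N. q w \<noteq> 0 \<and> f w = p w / q w"
        using * unfolding funs_zariski by blast
      obtain a b where ab: "a \<in> polys C" "b \<in> polys C" "\<forall>v\<in>V. b v \<noteq> 0 \<and> p (\<phi> v) = a v / b v"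
        using rational_on_pullback[OF assms(2) N(4)] unfolding rational_on_def by auto
      obtain r s where rs: "r \<in> polys C" "s \<in> polys C" "\<forall>v\<in>V. s v \<noteq> 0 \<and> q (\<phi> v) = r v / s v"
        using rational_on_pullback[OF assms(2) N(5)] unfolding rational_on_def by auto
      let ?N = "{x \<in> points (zariski V C). \<phi> x \<in> N}"
      have "openin (topo (zariski V C)) ?N"
        using openin_continuous_map_preimage[OF cont N(1)] .
      moreover have "v \<in> ?N" "?N \<subseteq> ?U" using v N by auto
      moreover have "(\<lambda>x. a x * s x) \<in> polys C" "(\<lambda>x. b x * r x) \<in> polys C"
        using ab rs by (auto intro: polys_mult)
      moreover have "\<forall>w\<in>?N. b w * r w \<noteq> 0 \<and> (f \<circ> \<phi>) w = (a w * s w) / (b w * r w)"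
      proof
        fix w assume w: "w \<in> ?N"
        then have wV: "w \<in> V" and wN: "\<phi> w \<in> N" by auto
        have "q (\<phi> w) \<noteq> 0" "f (\<phi> w) = p (\<phi> w) / q (\<phi> w)" using N(6) wN by auto
        moreover have "b w \<noteq> 0" "p (\<phi> w) = a w / b w" "s w \<noteq> 0" "q (\<phi> w) = r w / s w"
          using ab rs wV by auto
        ultimately show "b w * r w \<noteq> 0 \<and> (f \<circ> \<phi>) w = (a w * s w) / (b w * r w)"
          by auto
      qed
      ultimately show "\<exists>W p q. openin (topo (zariski V C)) W \<and> v \<in> W \<and> W \<subseteq> ?U \<and>
        p \<in> polys C \<and> q \<in> polys C \<and> (\<forall>w\<in>W. q w \<noteq> 0 \<and> (f \<circ> \<phi>) w = p w / q w)"
        by blast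
    qed
  qed
qed

lemma isomorphic_zariski:
  assumes "\<And>v. v \<in> V \<Longrightarrow> \<phi> v \<in> W \<and> \<psi> (\<phi> v) = v" "\<And>w. w \<in> W \<Longrightarrow> \<psi> w \<in> V \<and> \<phi> (\<psi> w) = w"
    "\<And>d. d \<in> D \<Longrightarrow> d \<circ> \<phi> \<in> rational_on C V" "\<And>c. c \<in> C \<Longrightarrow> c \<circ> \<psi> \<in> rational_on D W"
  shows "zariski V C \<simeq>\<^sub>v zariski W D"
  by (rule isomorphicI[where f = \<phi> and g = \<psi>]) (use assms in \<open>auto intro!: morphism_zariski\<close>)

text \<open>A product of two polynomials is non-zero exactly where both factors are. Hence the
  principal open sets, given only as a generating family, form a basis.\<close>

lemma openin_zariski:
  "openin (topo (zariski V C)) U \<longleftrightarrow>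
     U \<subseteq> V \<and> (\<forall>x\<in>U. \<exists>p\<in>polys C. p x \<noteq> 0 \<and> {v \<in> V. p v \<noteq> 0} \<subseteq> U)" (is "?L \<longleftrightarrow> ?R")
proof
  assume ?L
  then have "generate_topology_on {{v \<in> V. p v \<noteq> 0} | p. p \<in> polys C} U"
    unfolding topo_zariski openin_topology_generated_by_iff .
  then show ?R
  proof induction
    case (Int a b)
    show ?case
    proof (intro conjI ballI)
      fix x assume "x \<in> a \<inter> b"
      then have x: "x \<in> a" "x \<in> b" by auto
      obtain p where p: "p \<in> polys C" "p x \<noteq> 0" "{v \<in> V. p v \<noteq> 0} \<subseteq> a"
        using Int.IH(1) x(1) by metis
      obtain q where q: "q \<in> polys C" "q x \<noteq> 0" "{v \<in> V. q v \<noteq> 0} \<subseteq> b"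
        using Int.IH(2) x(2) by metis
      from p q show "\<exists>p\<in>polys C. p x \<noteq> 0 \<and> {v \<in> V. p v \<noteq> 0} \<subseteq> a \<inter> b"
        by (intro bexI[of _ "\<lambda>v. p v * q v"]) (auto intro: polys_mult)
    qed (use Int in blast)
  next
    case (UN K)
    show ?case
    proof (intro conjI ballI)
      show "\<Union>K \<subseteq> V" using UN by blast
      fix x assume "x \<in> \<Union>K"
      then obtain k where "k \<in> K" "x \<in> k" by blast
      then obtain p where "p \<in> polys C" "p x \<noteq> 0" "{v \<in> V. p v \<noteq> 0} \<subseteq> k"
        using UN.IH[of k] by metis
      then show "\<exists>p\<in>polys C. p x \<noteq> 0 \<and> {v \<in> V. p v \<noteq> 0} \<subseteq> \<Union>K"
        using \<open>k \<in> K\<close> by blast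
    qed
  qed auto
next
  assume R: ?R
  let ?B = "{{v \<in> V. p v \<noteq> 0} | p. p \<in> polys C \<and> {v \<in> V. p v \<noteq> 0} \<subseteq> U}"
  have "U \<subseteq> \<Union>?B"
  proof
    fix x assume "x \<in> U"
    then obtain p where "p \<in> polys C" "p x \<noteq> 0" "{v \<in> V. p v \<noteq> 0} \<subseteq> U" "x \<in> V" using R by blast
    then show "x \<in> \<Union>?B" by (intro UnionI[of "{v \<in> V. p v \<noteq> 0}"] CollectI exI[of _ p]) auto
  qed
  then have "U = \<Union>?B" by blast
  moreover have "openin (topo (zariski V C)) (\<Union>?B)"
    by (rule openin_Union) (use openin_zariski_basic in blast)
  ultimately show ?L by simp
qed


text \<open>The same polynomials define the principal open sets of \<open>S\<close> and of
  \<open>V\<close>, so an open set of \<open>S\<close> is extended to \<open>V\<close> by taking the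
  principal open sets of the same polynomials there.\<close>

lemma openin_zariski_subset:
  assumes "S \<subseteq> V"
  shows "openin (topo (zariski S C)) T \<longleftrightarrow> (\<exists>U. openin (topo (zariski V C)) U \<and> T = U \<inter> S)"
proof
  assume T: "openin (topo (zariski S C)) T"
  let ?B = "{{v \<in> V. p v \<noteq> 0} | p. p \<in> polys C \<and> {v \<in> S. p v \<noteq> 0} \<subseteq> T}"
  have "openin (topo (zariski V C)) (\<Union>?B)"
    by (rule openin_Union) (use openin_zariski_basic in blast)
  moreover have "T \<subseteq> \<Union>?B \<inter> S"
  proof
    fix x assume x: "x \<in> T"
    have "T \<subseteq> S" using T unfolding openin_zariski by simp
    moreover obtain p where "p \<in> polys C" "p x \<noteq> 0" "{v \<in> S. p v \<noteq> 0} \<subseteq> T"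
      using T x unfolding openin_zariski by metis
    ultimately show "x \<in> \<Union>?B \<inter> S"
      using x assms by (intro IntI UnionI[of "{v \<in> V. p v \<noteq> 0}"] CollectI exI[of _ p]) auto
  qed
  moreover have "\<Union>?B \<inter> S \<subseteq> T" by auto
  ultimately show "\<exists>U. openin (topo (zariski V C)) U \<and> T = U \<inter> S" by (intro exI[of _ "\<Union>?B"]) auto
next
  assume "\<exists>U. openin (topo (zariski V C)) U \<and> T = U \<inter> S"
  then obtain U where U: "openin (topo (zariski V C)) U" "T = U \<inter> S" by auto
  show "openin (topo (zariski S C)) T"
    unfolding openin_zariski
  proof (intro conjI ballI)
    show "T \<subseteq> S" using U by simp
    fix x assume "x \<in> T"
    then obtain p where "p \<in> polys C" "p x \<noteq> 0" "{v \<in> V. p v \<noteq> 0} \<subseteq> U"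
      using U unfolding openin_zariski by (metis IntD1)
    then show "\<exists>p\<in>polys C. p x \<noteq> 0 \<and> {v \<in> S. p v \<noteq> 0} \<subseteq> T"
      using assms U(2) by (intro bexI[of _ p]) auto
  qed
qed

lemma topo_induced_zariski:
  "S \<subseteq> V \<Longrightarrow> topo (induced (zariski V C) S) = topo (zariski S C)"
  unfolding topology_eq by (simp add: induced_def openin_subtopology openin_zariski_subset[of S V])

section \<open>Regular functions on Zariski spaces and on their subsets\<close>

lemma funs_zariskiI:
  assumes "\<And>v. v \<in> U \<Longrightarrow> \<exists>W p q. openin (topo (zariski V C)) W \<and> v \<in> W \<and> W \<subseteq> U \<and>
        p \<in> polys C \<and> q \<in> polys C \<and> (\<forall>w\<in>W. q w \<noteq> 0 \<and> f w = p w / q w)"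
  shows "f \<in> funs (zariski V C) U"
  using assms unfolding funs_zariski by simp

lemma funs_zariskiE:
  assumes "f \<in> funs (zariski V C) U" "v \<in> U"
  obtains W p q where "openin (topo (zariski V C)) W" "v \<in> W" "W \<subseteq> U"
    "p \<in> polys C" "q \<in> polys C" "\<forall>w\<in>W. q w \<noteq> 0 \<and> f w = p w / q w"
proof -
  have "\<exists>W p q. openin (topo (zariski V C)) W \<and> v \<in> W \<and> W \<subseteq> U \<and>
        p \<in> polys C \<and> q \<in> polys C \<and> (\<forall>w\<in>W. q w \<noteq> 0 \<and> f w = p w / q w)"
    using assms unfolding funs_zariski by simp
  then show thesis using that by blast
qed

lemma polys_in_funs_zariski:
  assumes "openin (topo (zariski V C)) U" "p \<in> polys C"
  shows "p \<in> funs (zariski V C) U"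
  by (rule funs_zariskiI, rule exI[of _ U], rule exI[of _ p], rule exI[of _ "\<lambda>_. 1"])
    (use assms in \<open>auto intro: polys_const\<close>)

lemma sheaf_of_functions_zariski: "sheaf_of_functions (zariski V C)"
  unfolding sheaf_of_functions_def
proof (intro conjI allI impI)
  fix U U' f
  assume *: "openin (topo (zariski V C)) U \<and> openin (topo (zariski V C)) U' \<and> U \<subseteq> U' \<and>
    f \<in> funs (zariski V C) U'"
  show "f \<in> funs (zariski V C) U"
  proof (rule funs_zariskiI)
    fix v assume v: "v \<in> U"
    with * have f: "f \<in> funs (zariski V C) U'" "v \<in> U'" by auto
    obtain W p q where W: "openin (topo (zariski V C)) W" "v \<in> W" "W \<subseteq> U'"
      "p \<in> polys C" "q \<in> polys C" "\<forall>w\<in>W. q w \<noteq> 0 \<and> f w = p w / q w"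
      by (rule funs_zariskiE[OF f])
    show "\<exists>W p q. openin (topo (zariski V C)) W \<and> v \<in> W \<and> W \<subseteq> U \<and>
        p \<in> polys C \<and> q \<in> polys C \<and> (\<forall>w\<in>W. q w \<noteq> 0 \<and> f w = p w / q w)"
      using * v W by (intro exI[of _ "W \<inter> U"] exI[of _ p] exI[of _ q]) auto
  qed
next
  fix U f
  assume *: "openin (topo (zariski V C)) U \<and> (\<forall>x\<in>U. \<exists>V' g. openin (topo (zariski V C)) V' \<and>
    x \<in> V' \<and> V' \<subseteq> U \<and> g \<in> funs (zariski V C) V' \<and> (\<forall>y\<in>V'. f y = g y))"
  show "f \<in> funs (zariski V C) U"
  proof (rule funs_zariskiI)
    fix v assume "v \<in> U"
    then obtain V' g where V': "v \<in> V'" "V' \<subseteq> U" "g \<in> funs (zariski V C) V'" "\<forall>y\<in>V'. f y = g y"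
      using * by meson
    obtain W p q where W: "openin (topo (zariski V C)) W" "v \<in> W" "W \<subseteq> V'"
      "p \<in> polys C" "q \<in> polys C" "\<forall>w\<in>W. q w \<noteq> 0 \<and> g w = p w / q w"
      by (rule funs_zariskiE[OF V'(3,1)])
    show "\<exists>W p q. openin (topo (zariski V C)) W \<and> v \<in> W \<and> W \<subseteq> U \<and>
        p \<in> polys C \<and> q \<in> polys C \<and> (\<forall>w\<in>W. q w \<noteq> 0 \<and> f w = p w / q w)"
      using W V' by (intro exI[of _ W] exI[of _ p] exI[of _ q]) auto
  qed
qed

text \<open>The identity is an isomorphism: the topologies are equal and so are the regular
  functions on open sets. Equality of the two records is not claimed, because \<open>funs\<close> is
  unconstrained on sets that are not open.\<close>

lemma induced_zariski:
  assumes "S \<subseteq> V"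
  shows "induced (zariski V C) S \<simeq>\<^sub>v zariski S C"
proof -
  have funs_eq: "funs (induced (zariski V C) S) T = funs (zariski S C) T"
    if T: "openin (topo (zariski S C)) T" for T
  proof (rule equalityI; rule subsetI)
    fix f assume f: "f \<in> funs (induced (zariski V C) S) T"
    show "f \<in> funs (zariski S C) T"
    proof (rule funs_zariskiI)
      fix v assume v: "v \<in> T"
      with f obtain U g where U: "openin (topo (zariski V C)) U" "v \<in> U"
        "g \<in> funs (zariski V C) U" "\<forall>y\<in>U \<inter> T. f y = g y"
        unfolding induced_def by (auto simp del: points_zariski)
      obtain W p q where W: "openin (topo (zariski V C)) W" "v \<in> W" "W \<subseteq> U"
        "p \<in> polys C" "q \<in> polys C" "\<forall>w\<in>W. q w \<noteq> 0 \<and> g w = p w / q w"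
        by (rule funs_zariskiE[OF U(3,2)])
      have "T \<subseteq> S" using T unfolding openin_zariski by simp
      have "openin (topo (zariski S C)) (W \<inter> S)"
        using W(1) openin_zariski_subset[OF assms] by blast
      then have "openin (topo (zariski S C)) (W \<inter> S \<inter> T)" using T by blast
      moreover have "\<forall>w\<in>W \<inter> S \<inter> T. q w \<noteq> 0 \<and> f w = p w / q w" using W U by auto
      ultimately show "\<exists>W p q. openin (topo (zariski S C)) W \<and> v \<in> W \<and> W \<subseteq> T \<and>
        p \<in> polys C \<and> q \<in> polys C \<and> (\<forall>w\<in>W. q w \<noteq> 0 \<and> f w = p w / q w)"
        using v W \<open>T \<subseteq> S\<close> by (intro exI[of _ "W \<inter> S \<inter> T"] exI[of _ p] exI[of _ q]) auto
    qed
  next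
    fix f assume f: "f \<in> funs (zariski S C) T"
    have "\<exists>U g. openin (topo (zariski V C)) U \<and> v \<in> U \<and> g \<in> funs (zariski V C) U \<and>
       (\<forall>y\<in>U \<inter> T. f y = g y)" if v: "v \<in> T" for v
    proof -
      obtain W p q where W: "openin (topo (zariski S C)) W" "v \<in> W" "W \<subseteq> T"
        "p \<in> polys C" "q \<in> polys C" "\<forall>w\<in>W. q w \<noteq> 0 \<and> f w = p w / q w"
        by (rule funs_zariskiE[OF f v])
      obtain U where U: "openin (topo (zariski V C)) U" "W = U \<inter> S"
        using W(1) openin_zariski_subset[OF assms] by blast
      have "T \<subseteq> S" using T unfolding openin_zariski by simp
      \<comment> \<open>\<open>q\<close> is known to be non-zero only on \<open>W\<close>, inside
        \<open>S\<close>; the extension p / q to an open set of the larger space lives where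
        \<open>q\<close> does not vanish.\<close>
      let ?U = "U \<inter> {v \<in> V. q v \<noteq> 0}"
      have oU: "openin (topo (zariski V C)) ?U" using U(1) openin_zariski_basic[OF W(5)] by blast
      moreover have "v \<in> ?U" using W U \<open>T \<subseteq> S\<close> assms by auto
      moreover have "(\<lambda>w. p w / q w) \<in> funs (zariski V C) ?U"
        by (rule funs_zariskiI, rule exI[of _ ?U], rule exI[of _ p], rule exI[of _ q])
          (use oU W in auto)
      moreover have "\<forall>y\<in>?U \<inter> T. f y = p y / q y" using W U \<open>T \<subseteq> S\<close> by auto
      ultimately show ?thesis by blast
    qed
    then show "f \<in> funs (induced (zariski V C) S) T" unfolding induced_def by simp
  qed
  have "openin (topo (zariski S C)) T \<Longrightarrow> {x \<in> S. x \<in> T} = T" for T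
    unfolding openin_zariski by auto
  then have "morphism (induced (zariski V C) S) (zariski S C) id"
    "morphism (zariski S C) (induced (zariski V C) S) id"
    unfolding morphism_def topo_induced_zariski[OF assms] using funs_eq by auto
  then show ?thesis by (rule isomorphicI) auto
qed

text \<open>If the coordinate c distinguishes x from y, then c(x) - c(y) is a regular function on
  the product that vanishes on the diagonal but not at (x, y). The non-vanishing loci of these
  functions cover the complement of the diagonal.\<close>

lemma separated_zariski:
  assumes "\<And>x y. x \<in> V \<Longrightarrow> y \<in> V \<Longrightarrow> x \<noteq> y \<Longrightarrow> \<exists>c\<in>C. c x \<noteq> c y"
  shows "separated (zariski V C)"
proof -
  let ?X = "zariski V C"
  let ?B = "{{z \<in> U \<times> U'. h z \<noteq> 0} | U U' h. openin (topo ?X) U \<and> openin (topo ?X) U' \<and>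
    h \<in> tensors ?X ?X U U'}"
  have V: "openin (topo ?X) V" using openin_topspace[of "topo ?X"] by simp
  have in_B: "{z \<in> V \<times> V. h z \<noteq> 0} \<in> ?B" if "h \<in> tensors ?X ?X V V" for h
    using that V by blast
  \<comment> \<open>The constant tensor 1 makes the full product a generating open set, which
    identifies the points of the product topology.\<close>
  have "(\<lambda>z. 1 * 1) \<in> tensors ?X ?X V V"
    using tensors_pure[OF polys_in_funs_zariski[OF V polys_const]
        polys_in_funs_zariski[OF V polys_const], of 1 1] .
  from in_B[OF this] have "V \<times> V \<subseteq> \<Union>?B" by auto
  moreover have "\<Union>?B \<subseteq> V \<times> V"
  proof (rule Union_least)
    fix b assume "b \<in> ?B"
    then obtain U U' where "openin (topo ?X) U" "openin (topo ?X) U'" "b \<subseteq> U \<times> U'" by blast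
    moreover from this have "U \<subseteq> V" "U' \<subseteq> V" unfolding openin_zariski by simp_all
    ultimately show "b \<subseteq> V \<times> V" by blast
  qed
  ultimately have points: "topspace (prod_topo ?X ?X) = V \<times> V"
    unfolding prod_topo_def topology_generated_by_topspace by (rule equalityI[rotated])
  let ?O = "V \<times> V - {(x, x) | x. x \<in> V}"
  have "openin (prod_topo ?X ?X) ?O"
    unfolding openin_subopen[of _ ?O]
  proof
    fix z assume z: "z \<in> ?O"
    then obtain x y where xy: "z = (x, y)" "x \<in> V" "y \<in> V" "x \<noteq> y" by auto
    then obtain c where c: "c \<in> C" "c x \<noteq> c y" using assms by blast
    \<comment> \<open>This is c(x) - c(y), spelled as a sum of two pure tensors.\<close>
    define h where "h = (\<lambda>z. c (fst z) * 1 + (- 1) * c (snd z))"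
    have "h \<in> tensors ?X ?X V V"
      unfolding h_def using c(1) V
      by (intro tensors_add tensors_pure[where g = "\<lambda>_. 1"] tensors_pure[where f = "\<lambda>_. - 1"]
          polys_in_funs_zariski polys_const polys_coord)
    then have "openin (prod_topo ?X ?X) {z \<in> V \<times> V. h z \<noteq> 0}"
      unfolding prod_topo_def by (intro topology_generated_by_Basis in_B)
    moreover have "z \<in> {z \<in> V \<times> V. h z \<noteq> 0}" using xy c unfolding h_def by simp
    moreover have "{z \<in> V \<times> V. h z \<noteq> 0} \<subseteq> ?O" unfolding h_def by auto
    ultimately show "\<exists>T. openin (prod_topo ?X ?X) T \<and> z \<in> T \<and> T \<subseteq> ?O" by blast
  qed
  then show ?thesis
    unfolding separated_def closedin_def by (auto simp: vprod_def points)
qed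

lemma affine_variety_cong: "X \<simeq>\<^sub>v Y \<Longrightarrow> affine_variety Y \<Longrightarrow> affine_variety X"
  unfolding affine_variety_def using isomorphic_trans by metis

lemma variety_zariski:
  assumes "affine_variety (zariski V C)"
    "\<And>x y. x \<in> V \<Longrightarrow> y \<in> V \<Longrightarrow> x \<noteq> y \<Longrightarrow> \<exists>c\<in>C. c x \<noteq> c y"
  shows "variety (zariski V C)"
  unfolding variety_def
proof (intro conjI exI[of _ "{V}"])
  show "separated (zariski V C)" using assms(2) by (rule separated_zariski)
  show "\<forall>U\<in>{V}. openin (topo (zariski V C)) U \<and> affine_variety (induced (zariski V C) U)"
    using openin_topspace[of "topo (zariski V C)"]
      affine_variety_cong[OF induced_zariski[OF subset_refl] assms(1)] by simp
qed (simp_all add: sheaf_of_functions_zariski)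


section \<open>Principal open subsets of closed sets\<close>

text \<open>A closed set intersected with one principal open set of the ambient space
  \<open>A\<close>. This class of sets is stable under both halves of a cut by one polynomial, and
  its members in affine space are affine varieties, so cuts can be iterated.\<close>

definition locally_principal :: "('a \<Rightarrow> complex) set \<Rightarrow> 'a set \<Rightarrow> 'a set \<Rightarrow> bool" where
  "locally_principal C A V \<longleftrightarrow>
     (\<exists>S\<subseteq>polys C. \<exists>q\<in>polys C. V = {v \<in> A. (\<forall>p\<in>S. p v = 0) \<and> q v \<noteq> 0})"

lemma locally_principal_zero:
  assumes "locally_principal C A V" "f \<in> polys C"
  shows "locally_principal C A {v \<in> V. f v = 0}"
proof -
  obtain S q where "S \<subseteq> polys C" "q \<in> polys C" "V = {v \<in> A. (\<forall>p\<in>S. p v = 0) \<and> q v \<noteq> 0}"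
    using assms(1) unfolding locally_principal_def by auto
  then show ?thesis
    unfolding locally_principal_def using assms(2)
    by (intro exI[of _ "insert f S"] conjI bexI[of _ q]) auto
qed

lemma locally_principal_nonzero:
  assumes "locally_principal C A V" "f \<in> polys C"
  shows "locally_principal C A {v \<in> V. f v \<noteq> 0}"
proof -
  obtain S q where "S \<subseteq> polys C" "q \<in> polys C" "V = {v \<in> A. (\<forall>p\<in>S. p v = 0) \<and> q v \<noteq> 0}"
    using assms(1) unfolding locally_principal_def by auto
  then show ?thesis
    unfolding locally_principal_def using assms(2)
    by (intro exI[of _ S] conjI bexI[of _ "\<lambda>v. f v * q v"]) (auto intro: polys_mult)
qed

lemma polys_compose:
  assumes "\<And>c. c \<in> C \<Longrightarrow> c \<circ> \<phi> \<in> polys D" "p \<in> polys C"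
  shows "p \<circ> \<phi> \<in> polys D"
  using assms(2)
  by induction (auto simp: comp_def assms(1)[unfolded comp_def] intro: polys.intros)

text \<open>Equations and the non-vanishing function are pulled back along a polynomial map. It is
  applied to the map from coordinate lists to matrix tuples.\<close>

lemma locally_principal_vimage:
  assumes "locally_principal C A V" "\<And>c. c \<in> C \<Longrightarrow> c \<circ> \<phi> \<in> polys D" "\<phi> ` B \<subseteq> A"
  shows "locally_principal D B {v \<in> B. \<phi> v \<in> V}"
proof -
  obtain S q where *: "S \<subseteq> polys C" "q \<in> polys C" "V = {v \<in> A. (\<forall>p\<in>S. p v = 0) \<and> q v \<noteq> 0}"
    using assms(1) unfolding locally_principal_def by auto
  then have "(\<lambda>p. p \<circ> \<phi>) ` S \<subseteq> polys D" "q \<circ> \<phi> \<in> polys D"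
    using polys_compose[of C \<phi> D] assms(2) by auto
  then show ?thesis
    unfolding locally_principal_def using *(3) assms(3)
    by (intro exI[of _ "(\<lambda>p. p \<circ> \<phi>) ` S"] conjI bexI[of _ "q \<circ> \<phi>"]) auto
qed

abbreviation affine_space :: "nat \<Rightarrow> complex list set" where
  "affine_space n \<equiv> {v. length v = n}"

text \<open>Rabinowitsch: the inverse of the non-vanishing function is a new coordinate.\<close>

lemma affine_variety_locally_principal:
  assumes "locally_principal (coords n) (affine_space n) V"
  shows "affine_variety (zariski V (coords n))"
proof -
  obtain S q where *: "S \<subseteq> polys (coords n)" "q \<in> polys (coords n)"
      "V = {v. length v = n \<and> (\<forall>p\<in>S. p v = 0) \<and> q v \<noteq> 0}"
    using assms unfolding locally_principal_def by auto
  define r where "r = (\<lambda>w. (q \<circ> take n) w * w ! n + - 1)"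
  define T where "T = insert r ((\<lambda>p. p \<circ> take n) ` S)"
  define W where "W = {w. length w = Suc n \<and> (\<forall>p\<in>T. p w = 0)}"
  have coord: "(\<lambda>w. w ! i) \<in> polys (coords (Suc n))" if "i \<le> n" for i
    using that by (intro polys_coord) (auto simp: coords_def)
  have compose: "p \<circ> take n \<in> polys (coords (Suc n))" if "p \<in> polys (coords n)" for p
  proof (rule polys_compose[OF _ that])
    fix c assume "c \<in> coords n"
    then obtain i where "c = (\<lambda>v. v ! i)" "i < n" unfolding coords_def by auto
    then show "c \<circ> take n \<in> polys (coords (Suc n))" using coord[of i] by (simp add: comp_def)
  qed
  have "r \<in> polys (coords (Suc n))"
    unfolding r_def by (intro polys_add polys_mult polys_const compose *(2) coord order_refl)
  then have "T \<subseteq> polys (coords (Suc n))"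
    unfolding T_def using *(1) compose by auto
  then have "algebraic_set (Suc n) W"
    unfolding algebraic_set_def W_def by blast
  moreover have "zariski V (coords n) \<simeq>\<^sub>v zariski W (coords (Suc n))"
  proof (rule isomorphic_zariski[where \<phi> = "\<lambda>v. v @ [1 / q v]" and \<psi> = "take n"])
    fix v assume "v \<in> V"
    then show "v @ [1 / q v] \<in> W \<and> take n (v @ [1 / q v]) = v"
      using * unfolding W_def T_def r_def by (auto simp: nth_append)
  next
    fix w assume "w \<in> W"
    then have w: "length w = Suc n" "q (take n w) * w ! n = 1" "\<forall>p\<in>S. p (take n w) = 0"
      unfolding W_def T_def r_def by auto
    have "q (take n w) \<noteq> 0" using w(2) by auto
    moreover from this have "1 / q (take n w) = w ! n"
      using w(2) by (simp add: divide_eq_eq mult.commute)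
    moreover have "take n w @ [w ! n] = w"
      using w(1) take_Suc_conv_app_nth[of n w] by simp
    ultimately show "take n w \<in> V \<and> take n w @ [1 / q (take n w)] = w"
      using w *(3) by auto
  next
    fix d assume "d \<in> coords (Suc n)"
    then obtain i where i: "d = (\<lambda>v. v ! i)" "i \<le> n" unfolding coords_def by auto
    show "d \<circ> (\<lambda>v. v @ [1 / q v]) \<in> rational_on (coords n) V"
    proof (cases "i < n")
      case True
      then have "(\<lambda>v. v ! i) \<in> rational_on (coords n) V"
        using polys_subset_rational_on polys_coord[of "\<lambda>v. v ! i" "coords n"]
        unfolding coords_def by blast
      then show ?thesis
        by (rule rational_on_cong) (use * True i in \<open>auto simp: nth_append\<close>)
    next
      case False
      show ?thesis
        by (rule rational_onI[where p = "\<lambda>_. 1", OF polys_const *(2)])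
          (use * False i in \<open>auto simp: nth_append\<close>)
    qed
  next
    fix c assume "c \<in> coords n"
    then have "c \<circ> take n \<in> polys (coords (Suc n))" by (intro compose polys_coord)
    then show "c \<circ> take n \<in> rational_on (coords (Suc n)) W"
      using polys_subset_rational_on by blast
  qed
  ultimately show ?thesis unfolding affine_variety_def by blast
qed

lemma variety_locally_principal:
  assumes "locally_principal (coords n) (affine_space n) V"
  shows "variety (zariski V (coords n))"
proof (rule variety_zariski)
  show "affine_variety (zariski V (coords n))"
    using assms by (rule affine_variety_locally_principal)
  fix x y assume "x \<in> V" "y \<in> V" "x \<noteq> y"
  moreover from this have "length x = n" "length y = n"
    using assms unfolding locally_principal_def by auto
  ultimately show "\<exists>c\<in>coords n. c x \<noteq> c y"
    unfolding coords_def by (auto simp: list_eq_iff_nth_eq)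
qed


section \<open>Scissor relations\<close>

lemma add_monoid_free_var_ring: "add_monoid free_var_ring = free_Abelian_group iso_classes"
  unfolding free_var_ring_def free_Abelian_group_def by simp

text \<open>
  Both differences are required, so that no use is made of the scissor relations being closed under
  negation.
\<close>

definition scissor_equivalent :: "(iso_class \<Rightarrow>\<^sub>0 int) \<Rightarrow> (iso_class \<Rightarrow>\<^sub>0 int) \<Rightarrow> bool"
    (infix \<open>\<sim>\<^sub>s\<close> 50) where
  "a \<sim>\<^sub>s b \<longleftrightarrow> a - b \<in> scissor_relations \<and> b - a \<in> scissor_relations"

lemma scissor_relations_zero: "0 \<in> scissor_relations"
  using generate.one[of "add_monoid free_var_ring"]
  unfolding scissor_relations_def add_monoid_free_var_ring by simp

lemma scissor_relations_add:
  "a \<in> scissor_relations \<Longrightarrow> b \<in> scissor_relations \<Longrightarrow> a + b \<in> scissor_relations"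
  using generate.eng[of a "add_monoid free_var_ring" _ b]
  unfolding scissor_relations_def add_monoid_free_var_ring by simp

lemma scissor_equivalent_refl: "a \<sim>\<^sub>s a"
  unfolding scissor_equivalent_def by (simp add: scissor_relations_zero)

lemma scissor_equivalent_sym: "a \<sim>\<^sub>s b \<Longrightarrow> b \<sim>\<^sub>s a"
  unfolding scissor_equivalent_def by simp

lemma scissor_equivalent_trans: "a \<sim>\<^sub>s b \<Longrightarrow> b \<sim>\<^sub>s c \<Longrightarrow> a \<sim>\<^sub>s c"
  unfolding scissor_equivalent_def
  using scissor_relations_add[of "a - b" "b - c"] scissor_relations_add[of "c - b" "b - a"] by simp

lemma scissor_equivalent_add: "a \<sim>\<^sub>s b \<Longrightarrow> a + c \<sim>\<^sub>s b + c"
  unfolding scissor_equivalent_def by simp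

lemma coset_scissor_relations:
  "scissor_relations +>\<^bsub>free_var_ring\<^esub> a = {h + a | h. h \<in> scissor_relations}"
  unfolding a_r_coset_def r_coset_def by (auto simp: free_var_ring_def)

text \<open>Rewrite h + a as (h + (a - b)) + b, where h + (a - b) is again a relation; the other
  inclusion is the same with a and b exchanged.\<close>

lemma scissor_equivalent_coset:
  assumes "a \<sim>\<^sub>s b"
  shows "scissor_relations +>\<^bsub>free_var_ring\<^esub> a = scissor_relations +>\<^bsub>free_var_ring\<^esub> b"
proof -
  have sub: "{h + a | h. h \<in> scissor_relations} \<subseteq> {h + b | h. h \<in> scissor_relations}"
    if "a - b \<in> scissor_relations" for a b
  proof clarify
    fix h assume "h \<in> scissor_relations"
    then have "h + (a - b) \<in> scissor_relations" using that by (rule scissor_relations_add)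
    then show "\<exists>h'. h + a = h' + b \<and> h' \<in> scissor_relations"
      by (intro exI[of _ "h + (a - b)"]) simp
  qed
  show ?thesis
    unfolding coset_scissor_relations
    using assms sub[of a b] sub[of b a] unfolding scissor_equivalent_def by blast
qed

text \<open>One of the two differences is a generator of the scissor relations, after the induced
  structures have been replaced by isomorphic Zariski spaces. The other is the inverse of that
  generator.\<close>

lemma scissor_equivalent_cut:
  assumes V: "locally_principal (coords n) (affine_space n) V" and f: "f \<in> polys (coords n)"
  shows "frag_of (iso_class (zariski V (coords n))) \<sim>\<^sub>s
    frag_of (iso_class (zariski {v \<in> V. f v = 0} (coords n))) +
    frag_of (iso_class (zariski {v \<in> V. f v \<noteq> 0} (coords n)))" (is "?a \<sim>\<^sub>s ?b + ?c")
proof -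
  let ?X = "zariski V (coords n)" and ?Z = "{v \<in> V. f v = 0}"
  have complement: "points ?X - ?Z = {v \<in> V. f v \<noteq> 0}" by auto
  have pieces: "iso_class (induced ?X ?Z) = iso_class (zariski ?Z (coords n))"
    "iso_class (induced ?X (points ?X - ?Z)) = iso_class (zariski {v \<in> V. f v \<noteq> 0} (coords n))"
    unfolding complement by (rule iso_class_cong[OF induced_zariski], blast)+
  let ?S = "{frag_of (iso_class X) - (frag_of (iso_class (induced X Z))
      + frag_of (iso_class (induced X (points X - Z)))) |
      (X :: pt fspace) Z. variety X \<and> closedin (topo X) Z}"
  have "frag_of (iso_class ?X) - (frag_of (iso_class (induced ?X ?Z))
      + frag_of (iso_class (induced ?X (points ?X - ?Z)))) \<in> ?S"
    using variety_locally_principal[OF V] closedin_zariski_basic[OF f, of V] by blast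
  then have S: "?a - (?b + ?c) \<in> ?S" unfolding pieces .
  have carrier: "frag_of (iso_class (zariski U (coords n))) \<in> carrier (free_Abelian_group iso_classes)"
    if "locally_principal (coords n) (affine_space n) U" for U
    using variety_locally_principal[OF that]
    unfolding free_Abelian_group_def iso_classes_def by auto
  note carriers = carrier[OF V] carrier[OF locally_principal_zero[OF V f]]
    carrier[OF locally_principal_nonzero[OF V f]]
  \<comment> \<open>The inverse in the free abelian group is identified with negation for elements
    supported on \<open>iso_classes\<close>, so all three classes have to be classes of
    varieties.\<close>
  have "?a - (?b + ?c) \<in> carrier (free_Abelian_group iso_classes)"
    using carriers keys_diff[of ?a "?b + ?c"] keys_add[of ?b ?c]
    unfolding free_Abelian_group_def by auto
  then have "inv\<^bsub>free_Abelian_group iso_classes\<^esub> (?a - (?b + ?c)) = (?b + ?c) - ?a"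
    by simp
  then show ?thesis
    using generate.incl[OF S, of "free_Abelian_group iso_classes"]
      generate.inv[OF S, of "free_Abelian_group iso_classes"]
    unfolding scissor_equivalent_def scissor_relations_def add_monoid_free_var_ring by simp
qed


section \<open>Tuples of matrices\<close>

type_synonym mat22 = "complex ^ 2 ^ 2"

definition mat2 :: "complex \<Rightarrow> complex \<Rightarrow> complex \<Rightarrow> complex \<Rightarrow> mat22" where
  "mat2 a b c d = vector [vector [a, b], vector [c, d]]"

lemma mat2_nth [simp]:
  "mat2 a b c d $ 1 $ 1 = a" "mat2 a b c d $ 1 $ 2 = b"
  "mat2 a b c d $ 2 $ 1 = c" "mat2 a b c d $ 2 $ 2 = d"
  unfolding mat2_def by simp_all

lemma mat22_eq_iff:
  "(A :: mat22) = B \<longleftrightarrow> A $ 1 $ 1 = B $ 1 $ 1 \<and> A $ 1 $ 2 = B $ 1 $ 2 \<and>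
     A $ 2 $ 1 = B $ 2 $ 1 \<and> A $ 2 $ 2 = B $ 2 $ 2"
  by (simp add: vec_eq_iff forall_2)

lemma mult_mat22_nth: "((A :: mat22) ** B) $ i $ j = A $ i $ 1 * B $ 1 $ j + A $ i $ 2 * B $ 2 $ j"
  by (simp add: matrix_matrix_mult_def sum_2)

lemma mat_1_nth [simp]:
  "(mat 1 :: mat22) $ 1 $ 1 = 1" "(mat 1 :: mat22) $ 1 $ 2 = 0"
  "(mat 1 :: mat22) $ 2 $ 1 = 0" "(mat 1 :: mat22) $ 2 $ 2 = 1"
  by (simp_all add: mat_def)

abbreviation matrix_space :: "nat \<Rightarrow> mat22 list set" where
  "matrix_space m \<equiv> {x. length x = m}"

text \<open>Matrix k occupies the positions 4k to 4k + 3, row by row. The flattening is there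
  because the scissor relations are generated by varieties whose points are complex lists.\<close>

definition entries_of :: "nat \<Rightarrow> mat22 list \<Rightarrow> complex list" where
  "entries_of m x = map (\<lambda>j. x ! (j div 4) $ (if j mod 4 < 2 then 1 else 2) $ (if even j then 1 else 2))
     [0..<4 * m]"

definition matrices_of :: "nat \<Rightarrow> complex list \<Rightarrow> mat22 list" where
  "matrices_of m v = map (\<lambda>k. mat2 (v ! (4 * k)) (v ! (4 * k + 1)) (v ! (4 * k + 2)) (v ! (4 * k + 3)))
     [0..<m]"

lemma length_entries_of [simp]: "length (entries_of m x) = 4 * m"
  and length_matrices_of [simp]: "length (matrices_of m v) = m"
  unfolding entries_of_def matrices_of_def by simp_all

lemma entries_of_nth:
  assumes "k < m"
  shows "entries_of m x ! (4 * k) = x ! k $ 1 $ 1" "entries_of m x ! (4 * k + 1) = x ! k $ 1 $ 2"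
    "entries_of m x ! (4 * k + 2) = x ! k $ 2 $ 1" "entries_of m x ! (4 * k + 3) = x ! k $ 2 $ 2"
proof -
  have "(4 * k + 1) div 4 = k" "(4 * k + 2) div 4 = k" "(4 * k + 3) div 4 = k"
    "(4 * k + 1) mod 4 = 1" "(4 * k + 2) mod 4 = 2" "(4 * k + 3) mod 4 = 3"
    by presburger+
  then show "entries_of m x ! (4 * k) = x ! k $ 1 $ 1" "entries_of m x ! (4 * k + 1) = x ! k $ 1 $ 2"
    "entries_of m x ! (4 * k + 2) = x ! k $ 2 $ 1" "entries_of m x ! (4 * k + 3) = x ! k $ 2 $ 2"
    using assms unfolding entries_of_def by simp_all
qed

lemma less_4_mult_cases:
  assumes "(j :: nat) < 4 * m"
  obtains k where "k < m" "j = 4 * k \<or> j = 4 * k + 1 \<or> j = 4 * k + 2 \<or> j = 4 * k + 3"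
proof
  show "j div 4 < m" using assms by simp
  show "j = 4 * (j div 4) \<or> j = 4 * (j div 4) + 1 \<or> j = 4 * (j div 4) + 2 \<or> j = 4 * (j div 4) + 3"
    by presburger
qed

lemma matrices_of_nth:
  "k < m \<Longrightarrow> matrices_of m v ! k =
     mat2 (v ! (4 * k)) (v ! (4 * k + 1)) (v ! (4 * k + 2)) (v ! (4 * k + 3))"
  unfolding matrices_of_def by simp

lemma matrices_of_entries_of: "length x = m \<Longrightarrow> matrices_of m (entries_of m x) = x"
  by (rule nth_equalityI)
    (simp, simp only: matrices_of_nth entries_of_nth mat22_eq_iff mat2_nth
      length_matrices_of)

lemma entries_of_matrices_of:
  assumes "length v = 4 * m"
  shows "entries_of m (matrices_of m v) = v"
proof (rule nth_equalityI)
  fix j assume "j < length (entries_of m (matrices_of m v))"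
  then have "j < 4 * m" by simp
  then obtain k where "k < m" "j = 4 * k \<or> j = 4 * k + 1 \<or> j = 4 * k + 2 \<or> j = 4 * k + 3"
    by (rule less_4_mult_cases)
  then show "entries_of m (matrices_of m v) ! j = v ! j"
    by (elim disjE) (simp_all only: entries_of_nth matrices_of_nth mat2_nth)
qed (use assms in simp)

lemma matrix_coords_matrices_of:
  assumes "d \<in> matrix_coords m"
  shows "d \<circ> matrices_of m \<in> polys (coords (4 * m))"
proof -
  obtain k i j where d: "d = (\<lambda>x. x ! k $ i $ j)" "k < m"
    using assms unfolding matrix_coords_def by auto
  have "(\<lambda>v. v ! l) \<in> polys (coords (4 * m))" if "l < 4 * m" for l
    using that by (intro polys_coord) (auto simp: coords_def)
  then show ?thesis
    using d exhaust_2[of i] exhaust_2[of j] by (auto simp: comp_def matrices_of_nth)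
qed

lemma coords_entries_of:
  assumes "d \<in> coords (4 * m)"
  shows "d \<circ> entries_of m \<in> polys (matrix_coords m)"
proof -
  obtain l where d: "d = (\<lambda>v. v ! l)" "l < 4 * m"
    using assms unfolding coords_def by auto
  obtain k where k: "k < m" "l = 4 * k \<or> l = 4 * k + 1 \<or> l = 4 * k + 2 \<or> l = 4 * k + 3"
    using d(2) by (rule less_4_mult_cases)
  have "(\<lambda>x. x ! k $ i $ j) \<in> polys (matrix_coords m)" for i j
    using k(1) by (intro polys_coord) (auto simp: matrix_coords_def)
  then show ?thesis
    unfolding d(1) comp_def using k(2) by (elim disjE) (simp_all only: entries_of_nth[OF k(1)])
qed

lemma isomorphic_matrices_of:
  assumes "V \<subseteq> matrix_space m"
  shows "zariski V (matrix_coords m) \<simeq>\<^sub>v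
    zariski {v \<in> affine_space (4 * m). matrices_of m v \<in> V} (coords (4 * m))"
proof (rule isomorphic_zariski[where \<phi> = "entries_of m" and \<psi> = "matrices_of m"])
  fix d assume "d \<in> coords (4 * m)"
  then show "d \<circ> entries_of m \<in> rational_on (matrix_coords m) V"
    using coords_entries_of polys_subset_rational_on by blast
next
  fix d assume "d \<in> matrix_coords m"
  then show "d \<circ> matrices_of m \<in> rational_on (coords (4 * m))
      {v \<in> affine_space (4 * m). matrices_of m v \<in> V}"
    using matrix_coords_matrices_of polys_subset_rational_on by blast
qed (use assms in \<open>auto simp: matrices_of_entries_of entries_of_matrices_of subset_iff\<close>)

definition matrix_class :: "nat \<Rightarrow> mat22 list set \<Rightarrow> (iso_class \<Rightarrow>\<^sub>0 int)" where
  "matrix_class m V = frag_of (iso_class (zariski V (matrix_coords m)))"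

text \<open>The cut takes place in the coordinate lists; flattening is an isomorphism on
  \<open>V\<close> and on each piece, so it does not change the three classes.\<close>

lemma matrix_class_cut:
  assumes V: "locally_principal (matrix_coords m) (matrix_space m) V"
    and f: "f \<in> polys (matrix_coords m)"
  shows "matrix_class m V \<sim>\<^sub>s matrix_class m {v \<in> V. f v = 0} + matrix_class m {v \<in> V. f v \<noteq> 0}"
proof -
  let ?W = "\<lambda>U. {v \<in> affine_space (4 * m). matrices_of m v \<in> U}"
  have "V \<subseteq> matrix_space m" using V unfolding locally_principal_def by auto
  then have transfer: "matrix_class m U = frag_of (iso_class (zariski (?W U) (coords (4 * m))))"
    if "U \<subseteq> V" for U
    unfolding matrix_class_def using that
    by (intro arg_cong[where f = frag_of] iso_class_cong isomorphic_matrices_of) auto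
  have W: "locally_principal (coords (4 * m)) (affine_space (4 * m)) (?W V)"
    by (rule locally_principal_vimage[OF V]) (auto intro: matrix_coords_matrices_of)
  have "f \<circ> matrices_of m \<in> polys (coords (4 * m))"
    by (rule polys_compose[OF matrix_coords_matrices_of f])
  from scissor_equivalent_cut[OF W this] show ?thesis
    by (simp add: transfer conj_assoc)
qed

section \<open>Matrix-valued functions\<close>

text \<open>The adjugate: the inverse for determinant 1, but polynomial in the entries on the space
  of all matrices.\<close>

definition adj2 :: "mat22 \<Rightarrow> mat22" where
  "adj2 A = mat2 (A $ 2 $ 2) (- A $ 1 $ 2) (- A $ 2 $ 1) (A $ 1 $ 1)"

definition matrix_fun_over :: "('a \<Rightarrow> complex) set \<Rightarrow> ('a \<Rightarrow> mat22) \<Rightarrow> bool" where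
  "matrix_fun_over R F \<longleftrightarrow> (\<forall>i j. (\<lambda>x. F x $ i $ j) \<in> R)"

lemma matrix_fun_over_mat2:
  "a \<in> R \<Longrightarrow> b \<in> R \<Longrightarrow> c \<in> R \<Longrightarrow> d \<in> R \<Longrightarrow> matrix_fun_over R (\<lambda>x. mat2 (a x) (b x) (c x) (d x))"
  unfolding matrix_fun_over_def forall_2 by simp

lemma matrix_fun_over_nth: "matrix_fun_over R F \<Longrightarrow> (\<lambda>x. F x $ i $ j) \<in> R"
  unfolding matrix_fun_over_def by simp

lemma matrix_fun_over_const: "function_algebra R \<Longrightarrow> matrix_fun_over R (\<lambda>_. A)"
  unfolding matrix_fun_over_def by (simp add: function_algebra_const)

lemma matrix_fun_over_mult:
  "function_algebra R \<Longrightarrow> matrix_fun_over R F \<Longrightarrow> matrix_fun_over R G \<Longrightarrow>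
     matrix_fun_over R (\<lambda>x. F x ** G x)"
  unfolding matrix_fun_over_def mult_mat22_nth
  by (auto intro!: function_algebra_add function_algebra_mult)

lemma matrix_fun_over_adj2:
  assumes "function_algebra R" "matrix_fun_over R F"
  shows "matrix_fun_over R (\<lambda>x. adj2 (F x))"
  unfolding adj2_def
  by (intro matrix_fun_over_mat2 matrix_fun_over_nth function_algebra_uminus assms)

lemma det_function_algebra:
  assumes "function_algebra R" "matrix_fun_over R F"
  shows "(\<lambda>x. det (F x)) \<in> R"
  unfolding det_2
  by (intro function_algebra_diff function_algebra_mult matrix_fun_over_nth assms)

lemma matrix_fun_over_foldr:
  assumes "function_algebra R" "\<And>i. i \<in> set is \<Longrightarrow> matrix_fun_over R (F i)"
  shows "matrix_fun_over R (\<lambda>x. foldr (**) (map (\<lambda>i. F i x) is) (mat 1))"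
  using assms(2)
proof (induction "is")
  case Nil
  then show ?case using matrix_fun_over_const[OF assms(1)] by simp
next
  case (Cons i "is")
  then show ?case using matrix_fun_over_mult[OF assms(1), of "F i"] by simp
qed

lemma matrix_fun_over_coord:
  "k < m \<Longrightarrow> matrix_fun_over (polys (matrix_coords m)) (\<lambda>x. x ! k)"
  unfolding matrix_fun_over_def matrix_coords_def by (auto intro: polys_coord)

lemma matrix_fun_over_mono: "R \<subseteq> R' \<Longrightarrow> matrix_fun_over R F \<Longrightarrow> matrix_fun_over R' F"
  unfolding matrix_fun_over_def by blast

section \<open>The group SL2\<close>

lemma adj2_inverse:
  assumes "det (A :: mat22) = 1"
  shows "A ** adj2 A = mat 1" "adj2 A ** A = mat 1" "det (adj2 A) = 1"
  using assms unfolding mat22_eq_iff mult_mat22_nth adj2_def det_2 by (simp_all add: algebra_simps)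

lemma group_SL2: "group SL2"
proof (rule groupI)
  fix A assume "A \<in> carrier SL2"
  then show "\<exists>B\<in>carrier SL2. B \<otimes>\<^bsub>SL2\<^esub> A = \<one>\<^bsub>SL2\<^esub>"
    using adj2_inverse[of A] by (intro bexI[of _ "adj2 A"]) (auto simp: SL2_def)
qed (auto simp: SL2_def det_mul matrix_mul_assoc)

lemma carrier_SL2: "A \<in> carrier SL2 \<longleftrightarrow> det A = 1"
  and mult_SL2: "A \<otimes>\<^bsub>SL2\<^esub> B = A ** B"
  and one_SL2: "\<one>\<^bsub>SL2\<^esub> = mat 1"
  unfolding SL2_def by simp_all

lemma inv_SL2: "A \<in> carrier SL2 \<Longrightarrow> inv\<^bsub>SL2\<^esub> A = adj2 A"
  by (rule group.inv_equality[OF group_SL2])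
    (auto simp: carrier_SL2 mult_SL2 one_SL2 adj2_inverse)


section \<open>Trading commutators for squares\<close>

definition surface_factor :: "('a, 'b) monoid_scheme \<Rightarrow> bool \<Rightarrow> 'a \<Rightarrow> 'a \<Rightarrow> 'a" where
  "surface_factor G s a b = (if s then a \<otimes>\<^bsub>G\<^esub> a \<otimes>\<^bsub>G\<^esub> (b \<otimes>\<^bsub>G\<^esub> b) else commutator G a b)"

text \<open>The word that interpolates between the two surfaces: \<open>k\<close> is the number of
  leading commutators already traded for squares, from 0 (orientable) to \<open>g\<close>
  (nonorientable).\<close>

definition hybrid_word :: "('a, 'b) monoid_scheme \<Rightarrow> nat \<Rightarrow> nat \<Rightarrow> 'a list \<Rightarrow> 'a" where
  "hybrid_word G g k x =
     list_prod G (map (\<lambda>i. surface_factor G (i < k) (x ! (2 * i)) (x ! (2 * i + 1))) [0..<g])"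

definition hybrid_reps :: "('a, 'b) monoid_scheme \<Rightarrow> nat \<Rightarrow> nat \<Rightarrow> 'a list set" where
  "hybrid_reps G g k =
     {x. length x = 2 * g \<and> set x \<subseteq> carrier G \<and> hybrid_word G g k x = \<one>\<^bsub>G\<^esub>}"

lemma hybrid_reps_0: "hybrid_reps G g 0 = reps_orientable G g"
  unfolding hybrid_reps_def hybrid_word_def reps_orientable_def surface_factor_def by simp

text \<open>The conjugator is a function of c alone, and c is what the new pair still determines
  through its product. The function \<open>h\<close> stays a parameter because each stratum uses its
  own.\<close>

definition square_in :: "('a, 'b) monoid_scheme \<Rightarrow> ('a \<Rightarrow> 'a) \<Rightarrow> nat \<Rightarrow> 'a list \<Rightarrow> 'a list" where
  "square_in G h k x = (let a = x ! (2 * k) \<otimes>\<^bsub>G\<^esub> h (x ! (2 * k + 1)) in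
     x[2 * k := a, 2 * k + 1 := inv\<^bsub>G\<^esub> a \<otimes>\<^bsub>G\<^esub> inv\<^bsub>G\<^esub> (x ! (2 * k + 1))])"

definition square_out :: "('a, 'b) monoid_scheme \<Rightarrow> ('a \<Rightarrow> 'a) \<Rightarrow> nat \<Rightarrow> 'a list \<Rightarrow> 'a list" where
  "square_out G h k y = (let c = inv\<^bsub>G\<^esub> (y ! (2 * k) \<otimes>\<^bsub>G\<^esub> y ! (2 * k + 1)) in
     y[2 * k := y ! (2 * k) \<otimes>\<^bsub>G\<^esub> inv\<^bsub>G\<^esub> (h c), 2 * k + 1 := c])"

lemma set_subset_nth: "set x \<subseteq> A \<longleftrightarrow> (\<forall>i<length x. x ! i \<in> A)"
  by (auto simp: set_conv_nth)

section \<open>Identities and substitutions valid in any group\<close>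

context group
begin

lemma list_prod_closed: "set xs \<subseteq> carrier G \<Longrightarrow> list_prod G xs \<in> carrier G"
  by (induction xs) (auto simp: list_prod_def)

lemma list_prod_append:
  "set xs \<subseteq> carrier G \<Longrightarrow> set ys \<subseteq> carrier G \<Longrightarrow>
     list_prod G (xs @ ys) = list_prod G xs \<otimes> list_prod G ys"
proof (induction xs)
  case Nil
  then show ?case using list_prod_closed[of ys] by (simp add: list_prod_def)
next
  case (Cons a xs)
  then show ?case
    using list_prod_closed[of xs] list_prod_closed[of ys] by (simp add: list_prod_def m_assoc)
qed

text \<open>Bridges the two shapes of the word: the nonorientable relation multiplies single
  squares, \<open>hybrid_word\<close> multiplies one factor per pair of entries.\<close>

lemma list_prod_pairs:
  "(\<And>i. i < 2 * n \<Longrightarrow> f i \<in> carrier G) \<Longrightarrow>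
     list_prod G (map f [0..<2 * n]) = list_prod G (map (\<lambda>i. f (2 * i) \<otimes> f (2 * i + 1)) [0..<n])"
proof (induction n)
  case (Suc n)
  have [simp]: "f (2 * n) \<in> carrier G" "f (Suc (2 * n)) \<in> carrier G" using Suc.prems by simp_all
  let ?p = "\<lambda>i. f (2 * i) \<otimes> f (2 * i + 1)"
  have closed: "set (map f [0..<2 * n]) \<subseteq> carrier G" "set (map ?p [0..<n]) \<subseteq> carrier G"
    using Suc.prems by auto
  have "list_prod G (map f [0..<2 * Suc n]) = list_prod G (map f [0..<2 * n] @ [f (2 * n), f (2 * n + 1)])"
    by simp
  also have "\<dots> = list_prod G (map f [0..<2 * n]) \<otimes> ?p n"
    by (subst list_prod_append[OF closed(1)]) (simp_all add: list_prod_def)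
  also have "\<dots> = list_prod G (map ?p [0..<n]) \<otimes> ?p n"
    using Suc by simp
  also have "\<dots> = list_prod G (map ?p [0..<n] @ [?p n])"
    by (subst list_prod_append[OF closed(2)]) (simp_all add: list_prod_def)
  finally show ?case by simp
qed simp

lemma hybrid_reps_full: "hybrid_reps G g g = reps_nonorientable G (2 * g)"
proof -
  have "list_prod G (map (\<lambda>a. a \<otimes> a) x) = hybrid_word G g g x"
    if x: "length x = 2 * g" "set x \<subseteq> carrier G" for x
  proof -
    have "map (\<lambda>a. a \<otimes> a) x = map (\<lambda>i. x ! i \<otimes> x ! i) [0..<2 * g]"
      by (rule nth_equalityI) (use x in auto)
    moreover have "x ! i \<otimes> x ! i \<in> carrier G" if "i < 2 * g" for i
      using x that nth_mem[of i x] by (intro m_closed) auto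
    ultimately have "list_prod G (map (\<lambda>a. a \<otimes> a) x) = list_prod G
        (map (\<lambda>i. x ! (2 * i) \<otimes> x ! (2 * i) \<otimes> (x ! (2 * i + 1) \<otimes> x ! (2 * i + 1))) [0..<g])"
      using list_prod_pairs[of g "\<lambda>i. x ! i \<otimes> x ! i"] by simp
    also have "\<dots> = hybrid_word G g g x"
      unfolding hybrid_word_def surface_factor_def
      by (intro arg_cong[where f = "list_prod G"] map_cong) simp_all
    finally show ?thesis .
  qed
  then show ?thesis unfolding hybrid_reps_def reps_nonorientable_def by auto
qed

lemma mult_inv_cancel:
  "x \<in> carrier G \<Longrightarrow> y \<in> carrier G \<Longrightarrow> x \<otimes> (inv x \<otimes> y) = y"
  "x \<in> carrier G \<Longrightarrow> y \<in> carrier G \<Longrightarrow> inv x \<otimes> (x \<otimes> y) = y"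
  by (simp_all add: m_assoc[symmetric])

text \<open>Since a' b' = c^-1, the word a' a' b' b' is a' c^-1 a'^-1 c^-1, the other standard word
  of the Klein bottle. Inserting a' = a h, the inner h c^-1 h^-1 is c, and what remains is
  [a, c].\<close>

lemma commutator_eq_squares:
  assumes [simp]: "a \<in> carrier G" "c \<in> carrier G" "h \<in> carrier G"
    and h: "h \<otimes> c = inv c \<otimes> h"
  defines "a' \<equiv> a \<otimes> h"
  defines "b' \<equiv> inv a' \<otimes> inv c"
  shows "commutator G a c = a' \<otimes> a' \<otimes> (b' \<otimes> b')"
proof -
  have "h \<otimes> inv c = c \<otimes> (inv c \<otimes> h) \<otimes> inv c" by (simp add: mult_inv_cancel)
  also have "\<dots> = c \<otimes> h" unfolding h[symmetric] by (simp add: m_assoc)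
  \<comment> \<open>The trailing x puts h c^-1 = c h into the form in which it rewrites inside a
    right-nested product.\<close>
  finally have h': "h \<otimes> (inv c \<otimes> x) = c \<otimes> (h \<otimes> x)" if "x \<in> carrier G" for x
    using that by (simp add: m_assoc[symmetric])
  have "a' \<otimes> a' \<otimes> (b' \<otimes> b') = a \<otimes> (h \<otimes> (inv c \<otimes> (inv h \<otimes> (inv a \<otimes> inv c))))"
    unfolding b'_def a'_def by (simp add: m_assoc inv_mult_group mult_inv_cancel)
  also have "\<dots> = commutator G a c"
    unfolding commutator_def by (simp add: h' m_assoc mult_inv_cancel)
  finally show ?thesis by simp
qed

lemma square_in_nth:
  assumes "2 * k + 1 < length x"
  shows "square_in G h k x ! i =
    (if i = 2 * k then x ! (2 * k) \<otimes> h (x ! (2 * k + 1))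
     else if i = 2 * k + 1 then inv (x ! (2 * k) \<otimes> h (x ! (2 * k + 1))) \<otimes> inv (x ! (2 * k + 1))
     else x ! i)"
  unfolding square_in_def Let_def using assms by (auto simp: nth_list_update)

lemma square_out_nth:
  assumes "2 * k + 1 < length y"
  shows "square_out G h k y ! i =
    (if i = 2 * k then y ! (2 * k) \<otimes> inv (h (inv (y ! (2 * k) \<otimes> y ! (2 * k + 1))))
     else if i = 2 * k + 1 then inv (y ! (2 * k) \<otimes> y ! (2 * k + 1)) else y ! i)"
  unfolding square_out_def Let_def using assms by (auto simp: nth_list_update)

lemma length_square [simp]:
  "length (square_in G h k x) = length x" "length (square_out G h k x) = length x"
  unfolding square_in_def square_out_def Let_def by simp_all

text \<open>The two words agree factor by factor: only the pair at index k is altered, and there the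
  commutator equals the product of the two new squares.\<close>

lemma hybrid_word_square_in:
  assumes "k < g" "length x = 2 * g" "set x \<subseteq> carrier G"
    and "h (x ! (2 * k + 1)) \<in> carrier G"
    and "h (x ! (2 * k + 1)) \<otimes> x ! (2 * k + 1) = inv (x ! (2 * k + 1)) \<otimes> h (x ! (2 * k + 1))"
  shows "hybrid_word G g (Suc k) (square_in G h k x) = hybrid_word G g k x"
  unfolding hybrid_word_def
proof (intro arg_cong[where f = "list_prod G"] map_cong refl)
  fix i assume "i \<in> set [0..<g]"
  let ?y = "square_in G h k x"
  have k: "2 * k + 1 < length x" using assms(1,2) by simp
  have carrier: "x ! (2 * k) \<in> carrier G" "x ! (2 * k + 1) \<in> carrier G"
    using assms(3) k unfolding set_subset_nth by auto
  show "surface_factor G (i < Suc k) (?y ! (2 * i)) (?y ! (2 * i + 1)) =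
    surface_factor G (i < k) (x ! (2 * i)) (x ! (2 * i + 1))"
  proof (cases "i = k")
    case True
    have "?y ! (2 * k) = x ! (2 * k) \<otimes> h (x ! (2 * k + 1))"
      "?y ! (2 * k + 1) = inv (x ! (2 * k) \<otimes> h (x ! (2 * k + 1))) \<otimes> inv (x ! (2 * k + 1))"
      unfolding square_in_nth[OF k] by simp_all
    then show ?thesis
      using commutator_eq_squares[OF carrier assms(4,5)] True unfolding surface_factor_def by simp
  next
    case False
    then have "2 * i \<noteq> 2 * k" "2 * i \<noteq> 2 * k + 1" "2 * i + 1 \<noteq> 2 * k" "2 * i + 1 \<noteq> 2 * k + 1"
      by presburger+
    then have "?y ! (2 * i) = x ! (2 * i)" "?y ! (2 * i + 1) = x ! (2 * i + 1)"
      unfolding square_in_nth[OF k] by simp_all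
    moreover have "i < Suc k \<longleftrightarrow> i < k" using False by auto
    ultimately show ?thesis by simp
  qed
qed

text \<open>The first conclusion recovers c from the new pair. It makes the substitution reversible
  and shows that the image satisfies the stratum condition on the same matrix.\<close>

lemma square_out_square_in:
  assumes "2 * k + 1 < length x" "set x \<subseteq> carrier G" "h (x ! (2 * k + 1)) \<in> carrier G"
  shows "inv (square_in G h k x ! (2 * k) \<otimes> square_in G h k x ! (2 * k + 1)) = x ! (2 * k + 1)"
    "square_out G h k (square_in G h k x) = x"
proof -
  have [simp]: "x ! (2 * k) \<in> carrier G" "x ! (2 * k + 1) \<in> carrier G"
    using assms(1,2) unfolding set_subset_nth by auto
  note [simp] = assms(3)
  show *: "inv (square_in G h k x ! (2 * k) \<otimes> square_in G h k x ! (2 * k + 1)) = x ! (2 * k + 1)"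
    unfolding square_in_nth[OF assms(1)] by (simp add: mult_inv_cancel del: One_nat_def)
  show "square_out G h k (square_in G h k x) = x"
  proof (rule nth_equalityI)
    fix i assume "i < length (square_out G h k (square_in G h k x))"
    have k: "2 * k + 1 < length (square_in G h k x)" using assms(1) by simp
    show "square_out G h k (square_in G h k x) ! i = x ! i"
      unfolding square_out_nth[OF k] * by (auto simp: square_in_nth[OF assms(1)] m_assoc simp del: One_nat_def)
  qed simp
qed

lemma square_in_square_out:
  assumes "2 * k + 1 < length y" "set y \<subseteq> carrier G"
    and "h (inv (y ! (2 * k) \<otimes> y ! (2 * k + 1))) \<in> carrier G"
  shows "square_in G h k (square_out G h k y) = y"
proof (rule nth_equalityI)
  fix i assume "i < length (square_in G h k (square_out G h k y))"
  have [simp]: "y ! (2 * k) \<in> carrier G" "y ! (2 * k + 1) \<in> carrier G"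
    using assms(1,2) unfolding set_subset_nth by auto
  note [simp] = assms(3)
  have k: "2 * k + 1 < length (square_out G h k y)" using assms(1) by simp
  show "square_in G h k (square_out G h k y) ! i = y ! i"
    unfolding square_in_nth[OF k]
    by (auto simp: square_out_nth[OF assms(1)] m_assoc mult_inv_cancel simp del: One_nat_def)
qed simp

lemma set_square_in:
  assumes "2 * k + 1 < length x" "set x \<subseteq> carrier G" "h (x ! (2 * k + 1)) \<in> carrier G"
  shows "set (square_in G h k x) \<subseteq> carrier G"
  using assms unfolding set_subset_nth square_in_nth[OF assms(1)] by auto

lemma set_square_out:
  assumes "2 * k + 1 < length y" "set y \<subseteq> carrier G"
    and "h (inv (y ! (2 * k) \<otimes> y ! (2 * k + 1))) \<in> carrier G"
  shows "set (square_out G h k y) \<subseteq> carrier G"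
  using assms unfolding set_subset_nth square_out_nth[OF assms(1)] by auto

end


section \<open>The strata of the hybrid varieties\<close>

lemma matrix_fun_over_rational_cong:
  assumes "matrix_fun_over (rational_on C V) F" "\<And>v. v \<in> V \<Longrightarrow> G v = F v"
  shows "matrix_fun_over (rational_on C V) G"
  unfolding matrix_fun_over_def
proof (intro allI)
  fix i j
  show "(\<lambda>x. G x $ i $ j) \<in> rational_on C V"
    by (rule rational_on_cong[OF matrix_fun_over_nth[OF assms(1)]]) (simp add: assms(2))
qed

text \<open>The defining equations are made polynomial on all matrix tuples by writing
  \<open>adj2\<close> for the inverse. The polynomial word agrees with the group word once the
  determinants are 1, and these determinant conditions are among the equations.\<close>

lemma locally_principal_hybrid_reps:
  "locally_principal (matrix_coords (2 * g)) (matrix_space (2 * g)) (hybrid_reps SL2 g k)"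
proof -
  let ?P = "polys (matrix_coords (2 * g))"
  define fac :: "bool \<Rightarrow> mat22 \<Rightarrow> mat22 \<Rightarrow> mat22" where
    "fac s a b = (if s then a ** a ** (b ** b) else a ** b ** adj2 a ** adj2 b)" for s a b
  define F :: "nat \<Rightarrow> mat22 list \<Rightarrow> mat22" where
    "F i x = fac (i < k) (x ! (2 * i)) (x ! (2 * i + 1))" for i x
  define word where "word x = foldr (**) (map (\<lambda>i. F i x) [0..<g]) (mat 1)" for x
  have F: "matrix_fun_over ?P (F i)" if "i < g" for i
  proof -
    have "matrix_fun_over ?P (\<lambda>x. x ! (2 * i))" "matrix_fun_over ?P (\<lambda>x. x ! (2 * i + 1))"
      using that by (auto intro: matrix_fun_over_coord)
    then show ?thesis
      unfolding F_def fac_def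
      by (cases "i < k") (simp_all only: if_True if_False matrix_fun_over_mult
          matrix_fun_over_adj2 function_algebra_polys)
  qed
  have word: "matrix_fun_over ?P word"
    unfolding word_def by (rule matrix_fun_over_foldr) (auto intro: F function_algebra_polys)
  define S where "S = (\<lambda>i x. det (x ! i) - 1) ` {..<2 * g} \<union>
    (\<lambda>(i, j) x. word x $ i $ j - mat 1 $ i $ j) ` UNIV"
  have "S \<subseteq> ?P"
    unfolding S_def
    using word by (auto intro!: function_algebra_diff[OF function_algebra_polys] polys_const
        det_function_algebra[OF function_algebra_polys] matrix_fun_over_coord matrix_fun_over_nth)
  \<comment> \<open>The condition that 1 differs from 0 is the non-vanishing of the constant
    function 1: the set is closed.\<close>
  moreover have "hybrid_reps SL2 g k = {x \<in> matrix_space (2 * g). (\<forall>p\<in>S. p x = 0) \<and> 1 \<noteq> (0 :: complex)}"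
  proof -
    have zero: "(\<forall>p\<in>S. p x = 0) \<longleftrightarrow> set x \<subseteq> carrier SL2 \<and> word x = mat 1"
      if "length x = 2 * g" for x
      using that unfolding S_def set_subset_nth carrier_SL2 ball_Un by (auto simp: vec_eq_iff)
    have word_eq: "word x = hybrid_word SL2 g k x" if x: "length x = 2 * g" "set x \<subseteq> carrier SL2" for x
    proof -
      have "map (\<lambda>i. F i x) [0..<g] =
          map (\<lambda>i. surface_factor SL2 (i < k) (x ! (2 * i)) (x ! (2 * i + 1))) [0..<g]"
      proof (rule map_cong[OF refl])
        fix i assume "i \<in> set [0..<g]"
        then have "x ! (2 * i) \<in> carrier SL2" "x ! (2 * i + 1) \<in> carrier SL2"
          using x unfolding set_subset_nth by auto
        then show "F i x = surface_factor SL2 (i < k) (x ! (2 * i)) (x ! (2 * i + 1))"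
          unfolding F_def fac_def surface_factor_def commutator_def by (simp add: inv_SL2 mult_SL2)
      qed
      moreover have "monoid.mult SL2 = (**)" by (simp add: SL2_def)
      ultimately show ?thesis
        unfolding word_def hybrid_word_def list_prod_def by (simp only: one_SL2)
    qed
    show ?thesis
    proof (rule Set.set_eqI)
      fix x
      show "x \<in> hybrid_reps SL2 g k \<longleftrightarrow>
          x \<in> {x \<in> matrix_space (2 * g). (\<forall>p\<in>S. p x = 0) \<and> 1 \<noteq> (0 :: complex)}"
        unfolding hybrid_reps_def one_SL2 using zero[of x] word_eq[of x]
        by (cases "length x = 2 * g") auto
    qed
  qed
  ultimately show ?thesis
    unfolding locally_principal_def by (intro exI[of _ S] conjI bexI[OF _ polys_const[of 1]]) auto
qed

text \<open>\<open>T\<close> is the condition on c that defines the stratum. On the target, c is the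
  inverse of the product of the new pair, written with \<open>adj2\<close>. The rationality
  assumption is stated for arbitrary \<open>V\<close> and \<open>F\<close> because \<open>h\<close>
  is applied to a coordinate on one side and to this inverse on the other.\<close>

lemma isomorphic_hybrid_strata:
  fixes h :: "mat22 \<Rightarrow> mat22"
  assumes "k < g"
    and h: "\<And>c. det c = 1 \<Longrightarrow> T c \<Longrightarrow> det (h c) = 1 \<and> h c ** c = adj2 c ** h c"
    and h_rational: "\<And>V F. matrix_fun_over (rational_on (matrix_coords (2 * g)) V) F \<Longrightarrow>
      (\<forall>x\<in>V. T (F x)) \<Longrightarrow> matrix_fun_over (rational_on (matrix_coords (2 * g)) V) (\<lambda>x. h (F x))"
  shows "zariski {x \<in> hybrid_reps SL2 g k. T (x ! (2 * k + 1))} (matrix_coords (2 * g)) \<simeq>\<^sub>v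
    zariski {y \<in> hybrid_reps SL2 g (Suc k). T (adj2 (y ! (2 * k) ** y ! (2 * k + 1)))}
      (matrix_coords (2 * g))" (is "zariski ?X ?C \<simeq>\<^sub>v zariski ?Y ?C")
proof -
  interpret SL2: group SL2 by (rule group_SL2)
  have hyb: "length x = 2 * g" "set x \<subseteq> carrier SL2" "2 * k + 1 < length x"
    "x ! (2 * k) \<in> carrier SL2" "x ! (2 * k + 1) \<in> carrier SL2"
    if "x \<in> hybrid_reps SL2 g l" for x l
  proof -
    show *: "length x = 2 * g" "set x \<subseteq> carrier SL2" "2 * k + 1 < length x"
      using that \<open>k < g\<close> unfolding hybrid_reps_def by auto
    show "x ! (2 * k) \<in> carrier SL2" "x ! (2 * k + 1) \<in> carrier SL2"
      using * unfolding set_subset_nth by auto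
  qed
  have h': "h c \<in> carrier SL2" "h c \<otimes>\<^bsub>SL2\<^esub> c = inv\<^bsub>SL2\<^esub> c \<otimes>\<^bsub>SL2\<^esub> h c"
    if "c \<in> carrier SL2" "T c" for c
    using h[of c] that by (simp_all add: carrier_SL2 mult_SL2 inv_SL2)
  define c where "c y = inv\<^bsub>SL2\<^esub> (y ! (2 * k) \<otimes>\<^bsub>SL2\<^esub> y ! (2 * k + 1))" for y
  have c: "c y = adj2 (y ! (2 * k) ** y ! (2 * k + 1))" "c y \<in> carrier SL2"
    if "y \<in> hybrid_reps SL2 g l" for y l
    using SL2.m_closed[OF hyb(4,5)[OF that]] SL2.inv_closed[OF SL2.m_closed[OF hyb(4,5)[OF that]]]
    unfolding c_def by (simp_all add: inv_SL2 mult_SL2)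
  show ?thesis
  proof (rule isomorphic_zariski[where \<phi> = "square_in SL2 h k" and \<psi> = "square_out SL2 h k"])
    fix x assume "x \<in> ?X"
    then have x: "x \<in> hybrid_reps SL2 g k" "T (x ! (2 * k + 1))" by auto
    note h'' = h'[OF hyb(5)[OF x(1)] x(2)]
    let ?y = "square_in SL2 h k x"
    have "hybrid_word SL2 g (Suc k) ?y = \<one>\<^bsub>SL2\<^esub>"
      using SL2.hybrid_word_square_in[of k g x h, OF \<open>k < g\<close> hyb(1,2)[OF x(1)] h''] x(1)
      unfolding hybrid_reps_def by simp
    moreover have "set ?y \<subseteq> carrier SL2"
      by (rule SL2.set_square_in[of k x h, OF hyb(3,2)[OF x(1)] h''(1)])
    ultimately have y: "?y \<in> hybrid_reps SL2 g (Suc k)"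
      using hyb(1)[OF x(1)] unfolding hybrid_reps_def by simp
    note out = SL2.square_out_square_in[of k x h, OF hyb(3,2)[OF x(1)] h''(1)]
    have "T (adj2 (?y ! (2 * k) ** ?y ! (2 * k + 1)))"
      using out(1) x(2) c(1)[OF y] unfolding c_def by simp
    with y out(2) show "?y \<in> ?Y \<and> square_out SL2 h k ?y = x" by simp
  next
    fix y assume "y \<in> ?Y"
    then have y: "y \<in> hybrid_reps SL2 g (Suc k)" "T (c y)" using c(1) by auto
    note h'' = h'[OF c(2)[OF y(1)] y(2)]
    let ?x = "square_out SL2 h k y"
    have xk: "?x ! (2 * k + 1) = c y"
      unfolding SL2.square_out_nth[of k y, OF hyb(3)[OF y(1)]] c_def by simp
    have set_x: "set ?x \<subseteq> carrier SL2"
      by (rule SL2.set_square_out[of k y h, OF hyb(3,2)[OF y(1)] h''(1)[unfolded c_def]])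
    have in_out: "square_in SL2 h k ?x = y"
      by (rule SL2.square_in_square_out[of k y h, OF hyb(3,2)[OF y(1)] h''(1)[unfolded c_def]])
    have len: "length ?x = 2 * g" using hyb(1)[OF y(1)] by simp
    \<comment> \<open>The invariance of the word is applied to the candidate preimage;
      \<open>in_out\<close> turns the altered word into the word of y.\<close>
    have "hybrid_word SL2 g k ?x = \<one>\<^bsub>SL2\<^esub>"
      using SL2.hybrid_word_square_in[of k g ?x h, OF \<open>k < g\<close> len set_x, unfolded xk in_out, OF h''] y(1)
      unfolding hybrid_reps_def by simp
    then show "?x \<in> ?X \<and> square_in SL2 h k ?x = y"
      using len set_x xk y(2) in_out unfolding hybrid_reps_def by simp
  next
    fix d assume "d \<in> ?C"
    then obtain l i j where d: "d = (\<lambda>x. x ! l $ i $ j)" "l < 2 * g" unfolding matrix_coords_def by auto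
    let ?R = "rational_on ?C ?X"
    note alg = function_algebra_rational_on[of ?C ?X]
    have coord: "matrix_fun_over ?R (\<lambda>x. x ! n)" if "n < 2 * g" for n
      using matrix_fun_over_mono[OF polys_subset_rational_on matrix_fun_over_coord[OF that]] .
    have k: "2 * k < 2 * g" "2 * k + 1 < 2 * g" using \<open>k < g\<close> by auto
    let ?a = "\<lambda>x. x ! (2 * k) ** h (x ! (2 * k + 1))"
    have a: "matrix_fun_over ?R ?a"
      by (intro matrix_fun_over_mult alg coord k h_rational) auto
    have b: "matrix_fun_over ?R (\<lambda>x. adj2 (?a x) ** adj2 (x ! (2 * k + 1)))"
      by (rule matrix_fun_over_mult[OF alg matrix_fun_over_adj2[OF alg a]
            matrix_fun_over_adj2[OF alg coord[OF k(2)]]])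
    \<comment> \<open>Group inverses are replaced by \<open>adj2\<close>, which is justified only on
      the stratum, where all determinants are 1; rationality depends on the values there
      alone.\<close>
    have "matrix_fun_over ?R (\<lambda>x. square_in SL2 h k x ! l)"
    proof (rule matrix_fun_over_rational_cong)
      show "matrix_fun_over ?R (\<lambda>x. if l = 2 * k then ?a x
          else if l = 2 * k + 1 then adj2 (?a x) ** adj2 (x ! (2 * k + 1)) else x ! l)"
        using a b coord[OF d(2)] by (cases "l = 2 * k"; cases "l = 2 * k + 1") simp_all
      fix x assume "x \<in> ?X"
      then have x: "x \<in> hybrid_reps SL2 g k" "T (x ! (2 * k + 1))" by auto
      have "?a x \<in> carrier SL2"
        using SL2.m_closed[OF hyb(4)[OF x(1)] h'(1)[OF hyb(5)[OF x(1)] x(2)]] by (simp add: mult_SL2)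
      then show "square_in SL2 h k x ! l = (if l = 2 * k then ?a x
          else if l = 2 * k + 1 then adj2 (?a x) ** adj2 (x ! (2 * k + 1)) else x ! l)"
        unfolding SL2.square_in_nth[of k x, OF hyb(3)[OF x(1)]] mult_SL2
        using hyb(5)[OF x(1)] by (simp add: inv_SL2)
    qed
    then show "d \<circ> square_in SL2 h k \<in> ?R"
      unfolding d(1) comp_def by (rule matrix_fun_over_nth)
  next
    fix d assume "d \<in> ?C"
    then obtain l i j where d: "d = (\<lambda>x. x ! l $ i $ j)" "l < 2 * g" unfolding matrix_coords_def by auto
    let ?R = "rational_on ?C ?Y"
    note alg = function_algebra_rational_on[of ?C ?Y]
    have coord: "matrix_fun_over ?R (\<lambda>x. x ! n)" if "n < 2 * g" for n
      using matrix_fun_over_mono[OF polys_subset_rational_on matrix_fun_over_coord[OF that]] .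
    have k: "2 * k < 2 * g" "2 * k + 1 < 2 * g" using \<open>k < g\<close> by auto
    let ?c = "\<lambda>y. adj2 (y ! (2 * k) ** y ! (2 * k + 1))"
    have b: "matrix_fun_over ?R ?c"
      by (intro matrix_fun_over_mult matrix_fun_over_adj2 alg coord k)
    then have a: "matrix_fun_over ?R (\<lambda>y. y ! (2 * k) ** adj2 (h (?c y)))"
      by (intro matrix_fun_over_mult matrix_fun_over_adj2 alg coord k h_rational) auto
    have "matrix_fun_over ?R (\<lambda>y. square_out SL2 h k y ! l)"
    proof (rule matrix_fun_over_rational_cong)
      show "matrix_fun_over ?R (\<lambda>y. if l = 2 * k then y ! (2 * k) ** adj2 (h (?c y))
          else if l = 2 * k + 1 then ?c y else y ! l)"
        using a b coord[OF d(2)] by (cases "l = 2 * k"; cases "l = 2 * k + 1") simp_all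
      fix y assume "y \<in> ?Y"
      then have y: "y \<in> hybrid_reps SL2 g (Suc k)" "T (c y)" using c(1) by auto
      show "square_out SL2 h k y ! l = (if l = 2 * k then y ! (2 * k) ** adj2 (h (?c y))
          else if l = 2 * k + 1 then ?c y else y ! l)"
        unfolding SL2.square_out_nth[of k y, OF hyb(3)[OF y(1)], folded c_def] c(1)[OF y(1), symmetric]
        using inv_SL2[OF h'(1)[OF c(2)[OF y(1)] y(2)]] by (simp add: mult_SL2)
    qed
    then show "d \<circ> square_out SL2 h k \<in> ?R"
      unfolding d(1) comp_def by (rule matrix_fun_over_nth)
  qed
qed

text \<open>
  An element \<open>c\<close> of \<open>SL2\<close> is conjugate to its inverse, and on each of the three strata below the
  conjugating matrix can be chosen to be a regular function of \<open>c\<close>. Finding it needs a square root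
  of \<open>-1\<close>.
\<close>

lemma adj2_conjugate_upper:
  assumes "c $ 1 $ 2 \<noteq> 0"
  defines "h \<equiv> mat2 \<i> 0 (- \<i> * (c $ 1 $ 1 - c $ 2 $ 2) / c $ 1 $ 2) (- \<i>)"
  shows "det h = 1 \<and> h ** c = adj2 c ** h"
  using assms(1) unfolding h_def mat22_eq_iff mult_mat22_nth adj2_def det_2
  by (simp add: field_simps)

text \<open>The same linear equation as for c12, now with the lower left entry of h set to zero, so
  that c21 becomes the denominator.\<close>

lemma adj2_conjugate_lower:
  assumes "c $ 2 $ 1 \<noteq> 0"
  defines "h \<equiv> mat2 \<i> (- \<i> * (c $ 1 $ 1 - c $ 2 $ 2) / c $ 2 $ 1) 0 (- \<i>)"
  shows "det h = 1 \<and> h ** c = adj2 c ** h"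
  using assms(1) unfolding h_def mat22_eq_iff mult_mat22_nth adj2_def det_2
  by (simp add: field_simps)

text \<open>For diagonal c the adjugate exchanges the two diagonal entries, and so does conjugation
  by the Weyl element. Both denominators of the previous formulas vanish here.\<close>

lemma adj2_conjugate_diagonal:
  assumes "c $ 1 $ 2 = 0" "c $ 2 $ 1 = 0"
  defines "h \<equiv> mat2 0 1 (- 1) 0"
  shows "det h = 1 \<and> h ** c = adj2 c ** h"
  using assms(1,2) unfolding h_def mat22_eq_iff mult_mat22_nth adj2_def det_2 by simp

lemma hybrid_class_Suc:
  assumes "k < g"
  shows "matrix_class (2 * g) (hybrid_reps SL2 g k) \<sim>\<^sub>s matrix_class (2 * g) (hybrid_reps SL2 g (Suc k))"
proof -
  let ?C = "matrix_coords (2 * g)" and ?cl = "matrix_class (2 * g)"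
  let ?H = "\<lambda>l. hybrid_reps SL2 g l"
  define upper lower diagonal :: "mat22 \<Rightarrow> bool" where
    "upper c \<longleftrightarrow> c $ 1 $ 2 \<noteq> 0" and "lower c \<longleftrightarrow> c $ 1 $ 2 = 0 \<and> c $ 2 $ 1 \<noteq> 0"
    and "diagonal c \<longleftrightarrow> c $ 1 $ 2 = 0 \<and> c $ 2 $ 1 = 0" for c
  have k: "2 * k < 2 * g" "2 * k + 1 < 2 * g" using assms by auto
  \<comment> \<open>Two successive cuts: by the entry (1,2), and then by the entry (2,1) on the zero
    locus of the first. \<open>F\<close> is left arbitrary so that the same cut serves c as a
    coordinate and c as the inverse of a product.\<close>
  have cut: "?cl (?H l) \<sim>\<^sub>s ?cl {x \<in> ?H l. diagonal (F x)} + ?cl {x \<in> ?H l. lower (F x)} +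
      ?cl {x \<in> ?H l. upper (F x)}" if F: "matrix_fun_over (polys ?C) F" for F l
  proof -
    note V = locally_principal_hybrid_reps[of g l]
    note entry = matrix_fun_over_nth[OF F]
    have "{v \<in> {x \<in> ?H l. F x $ 1 $ 2 = 0}. F v $ 2 $ 1 = 0} = {x \<in> ?H l. diagonal (F x)}"
      "{v \<in> {x \<in> ?H l. F x $ 1 $ 2 = 0}. F v $ 2 $ 1 \<noteq> 0} = {x \<in> ?H l. lower (F x)}"
      unfolding diagonal_def lower_def by auto
    then have "?cl {x \<in> ?H l. F x $ 1 $ 2 = 0} \<sim>\<^sub>s
        ?cl {x \<in> ?H l. diagonal (F x)} + ?cl {x \<in> ?H l. lower (F x)}"
      using matrix_class_cut[OF locally_principal_zero[OF V entry[of 1 2]] entry[of 2 1]] by simp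
    with matrix_class_cut[OF V entry[of 1 2]] show ?thesis
      unfolding upper_def by (blast intro: scissor_equivalent_trans scissor_equivalent_add)
  qed
  let ?c = "\<lambda>x :: mat22 list. x ! (2 * k + 1)"
  let ?c' = "\<lambda>y :: mat22 list. adj2 (y ! (2 * k) ** y ! (2 * k + 1))"
  \<comment> \<open>These rules reduce the rationality of h(c) to entries of c; the denominator
    demanded to be nowhere zero by \<open>rational_on_divide\<close> is the entry whose
    non-vanishing defines the stratum.\<close>
  note intros = matrix_fun_over_mat2 function_algebra_const function_algebra_mult function_algebra_diff
    rational_on_divide function_algebra_rational_on matrix_fun_over_nth
  have upper: "?cl {x \<in> ?H k. upper (?c x)} = ?cl {y \<in> ?H (Suc k). upper (?c' y)}"
    unfolding matrix_class_def
    by (intro arg_cong[where f = frag_of] iso_class_cong isomorphic_hybrid_strata[OF assms, of _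
          "\<lambda>c. mat2 \<i> 0 (- \<i> * (c $ 1 $ 1 - c $ 2 $ 2) / c $ 1 $ 2) (- \<i>)"] adj2_conjugate_upper
        intros) (auto simp: upper_def)
  have lower: "?cl {x \<in> ?H k. lower (?c x)} = ?cl {y \<in> ?H (Suc k). lower (?c' y)}"
    unfolding matrix_class_def
    by (intro arg_cong[where f = frag_of] iso_class_cong isomorphic_hybrid_strata[OF assms, of _
          "\<lambda>c. mat2 \<i> (- \<i> * (c $ 1 $ 1 - c $ 2 $ 2) / c $ 2 $ 1) 0 (- \<i>)"] adj2_conjugate_lower
        intros) (auto simp: lower_def)
  have diagonal: "?cl {x \<in> ?H k. diagonal (?c x)} = ?cl {y \<in> ?H (Suc k). diagonal (?c' y)}"
    unfolding matrix_class_def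
    by (intro arg_cong[where f = frag_of] iso_class_cong isomorphic_hybrid_strata[OF assms, of _
          "\<lambda>_. mat2 0 1 (- 1) 0"] adj2_conjugate_diagonal intros) (auto simp: diagonal_def)
  have c: "matrix_fun_over (polys ?C) ?c" "matrix_fun_over (polys ?C) ?c'"
    by (intro matrix_fun_over_coord matrix_fun_over_adj2 matrix_fun_over_mult function_algebra_polys k)+
  \<comment> \<open>The stratum classes on both sides are now equal, so one cut followed by the
    reverse of the other connects the two varieties.\<close>
  from cut[OF c(1), of k] show ?thesis
    unfolding upper lower diagonal
    by (rule scissor_equivalent_trans[OF _ scissor_equivalent_sym[OF cut[OF c(2)]]])
qed

lemma hybrid_class:
  "k \<le> g \<Longrightarrow> matrix_class (2 * g) (hybrid_reps SL2 g 0) \<sim>\<^sub>s matrix_class (2 * g) (hybrid_reps SL2 g k)"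
proof (induction k)
  case (Suc k)
  then have k: "k < g" by simp
  show ?case
    by (rule scissor_equivalent_trans[OF Suc.IH hybrid_class_Suc[OF k]]) (use k in simp)
qed (rule scissor_equivalent_refl)

theorem theorem6p7:
  fixes g :: nat
  shows "virtual_class (R_SL2_orientable g) = virtual_class (R_SL2_nonorientable (2 * g))"
proof -
  interpret SL2: group SL2 by (rule group_SL2)
  have "K0_class (R_SL2_orientable g) = K0_class (R_SL2_nonorientable (2 * g))"
    using scissor_equivalent_coset[OF hybrid_class[OF order_refl, of g]]
    unfolding hybrid_reps_0 SL2.hybrid_reps_full matrix_class_def
      K0_class_def R_SL2_orientable_def R_SL2_nonorientable_def .
  then show ?thesis unfolding virtual_class_def by simp
qed

end
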